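(* Let $r\ge 4$ be a fixed integer. There exists $\varepsilon=\varepsilon(r)>0$ such that, for any function $p=p(n)$ with $0\le p\le n^{-2/r+\varepsilon}$, the following holds. For some function $\pi=\pi(n)$ with $\pi\sim p^{\binom{r}{2}}$ (i.e. $\pi/p^{\binom r2}\to 1$ as $n\to\infty$), there is a coupling of the random graph $G=G(n,p)$ with the random hypergraph $H=H_r(n,\pi)$ such that, with probability tending to $1$ as $n\to\infty$, for every hyperedge of $H$ the graph $G$ contains a copy of $K_r$ (complete graph on $r$ vertices) whose vertex set is that hyperedge.
   Context: $H_r(n,\pi)$ denotes the random $r$-uniform hypergraph on vertex set $[n]=\{1,\dots,n\}$ in which each of the $\binom nr$ possible $r$-element hyperedges is present independently with probability $\pi$. $G(n,p)=H_2(n,p)$ is the binomial (Erdős–Rényi) random graph. A coupling means a joint probability space on which both random objects are defined with the correct marginal distributions. *)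

theory Defs
  imports "HOL-Probability.Probability" "HOL-Library.Landau_Symbols"
begin

definition possible_hyperedges :: "nat \<Rightarrow> nat \<Rightarrow> nat set set" where
  "possible_hyperedges r n = {e. e \<subseteq> {1..n} \<and> card e = r}"

text \<open>Graphs and hypergraphs on the vertex set \<open>{1..n}\<close> are represented by their edge sets.
  Beware that \<^const>\<open>bernoulli_pmf\<close> clamps its argument to the unit interval.\<close>

definition random_hypergraph :: "nat \<Rightarrow> nat \<Rightarrow> real \<Rightarrow> nat set set pmf" where
  "random_hypergraph r n q =
     map_pmf (\<lambda>b. {e \<in> possible_hyperedges r n. b e})
       (Pi_pmf (possible_hyperedges r n) False (\<lambda>_. bernoulli_pmf q))"

definition random_graph :: "nat \<Rightarrow> real \<Rightarrow> nat set set pmf" where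
  "random_graph n p = random_hypergraph 2 n p"

definition is_coupling :: "('a \<times> 'b) pmf \<Rightarrow> 'a pmf \<Rightarrow> 'b pmf \<Rightarrow> bool" where
  "is_coupling J A B \<longleftrightarrow> map_pmf fst J = A \<and> map_pmf snd J = B"

definition has_complete_graph_on :: "nat set set \<Rightarrow> nat \<Rightarrow> nat set \<Rightarrow> bool" where
  "has_complete_graph_on G r S \<longleftrightarrow>
     card S = r \<and> (\<forall>x\<in>S. \<forall>y\<in>S. x \<noteq> y \<longrightarrow> {x, y} \<in> G)"

end

theory Submission
  imports Defs "HOL-Real_Asymp.Real_Asymp"
begin

text \<open>
  Write \<open>A h\<close> for the event that \<open>G\<close> contains all pairs of the \<open>r\<close>-set \<open>h\<close>. The \<open>r\<close>-sets are exposed one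
  by one; as long as the conditional probability of \<open>A h\<close> given the revealed information is at least
  \<open>q\<close>, membership of \<open>h\<close> in \<open>H\<close> can be coupled so that it implies \<open>A h\<close>. Hence the coupling fails only
  if some \<open>j \<in> H\<close> had conditional probability below \<open>q\<close> when it was exposed. The revealed information
  is that \<open>A y\<close> holds for some \<open>y \<in> H\<close>, forcing a set \<open>R\<close> of edges, and fails for some \<open>i \<notin> H\<close>. Harris'
  inequality and the union bound show that the conditional probability of \<open>A j\<close> is at least
  \<open>p ^ card (pairs j - R) * (1 - Q)\<close>, where \<open>Q\<close> sums \<open>p ^ card (pairs i - (pairs j \<union> R))\<close> over the \<open>i\<close>
  sharing an edge outside \<open>R\<close> with \<open>j\<close>.

  Since \<open>j \<in> H\<close>, the edges of \<open>j\<close> and \<open>R\<close> all lie in the shadow of \<open>H\<close>. So \<open>Q\<close> is small as soon as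
  \<open>H\<close> has small maximum degree and every \<open>r\<close>-set that is a clique in the shadow of \<open>H\<close> is itself a
  hyperedge. Both hold with high probability in the random hypergraph by first moment bounds.
\<close>

subsection \<open>Random subsets\<close>

definition random_subset :: "'a set \<Rightarrow> real \<Rightarrow> 'a set pmf" where
  "random_subset P q =
     map_pmf (\<lambda>b. {e \<in> P. b e}) (Pi_pmf P False (\<lambda>_. bernoulli_pmf q))"

lemma random_hypergraph_eq_random_subset:
  "random_hypergraph r n q = random_subset (possible_hyperedges r n) q"
  by (simp add: random_hypergraph_def random_subset_def)

lemma set_pmf_random_subset: "set_pmf (random_subset P q) \<subseteq> Pow P"
  by (auto simp: random_subset_def)

lemma random_subset_empty: "random_subset {} q = return_pmf {}"
  by (simp add: random_subset_def)

lemma random_subset_insert: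
  assumes "finite P" "e \<notin> P"
  shows "random_subset (insert e P) q =
    bernoulli_pmf q \<bind>
      (\<lambda>b. if b then map_pmf (insert e) (random_subset P q) else random_subset P q)"
proof -
  have "random_subset (insert e P) q =
    map_pmf (\<lambda>(b, f). if b then insert e {x \<in> P. f x} else {x \<in> P. f x})
      (pair_pmf (bernoulli_pmf q) (Pi_pmf P False (\<lambda>_. bernoulli_pmf q)))"
    unfolding random_subset_def Pi_pmf_insert[OF assms] map_pmf_comp
    using assms by (intro map_pmf_cong) (auto split: prod.splits)
  also have "\<dots> = bernoulli_pmf q \<bind>
      (\<lambda>b. if b then map_pmf (insert e) (random_subset P q) else random_subset P q)"
    unfolding random_subset_def pair_pmf_def map_pmf_def bind_assoc_pmf bind_return_pmf
    by (intro bind_pmf_cong) (auto simp: bind_assoc_pmf bind_return_pmf)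
  finally show ?thesis .
qed

lemma pmf_bind_bernoulli:
  assumes "0 \<le> q" "q \<le> 1"
  shows "pmf (bernoulli_pmf q \<bind> f) x = q * pmf (f True) x + (1 - q) * pmf (f False) x"
  using assms by (simp add: pmf_bind)

lemma measure_bind_bernoulli:
  assumes "0 \<le> q" "q \<le> 1"
  shows "measure_pmf.prob (bernoulli_pmf q \<bind> f) Z =
    q * measure_pmf.prob (f True) Z + (1 - q) * measure_pmf.prob (f False) Z"
proof -
  have "ennreal (measure_pmf.prob (bernoulli_pmf q \<bind> f) Z) =
    ennreal (q * measure_pmf.prob (f True) Z + (1 - q) * measure_pmf.prob (f False) Z)"
    using assms
    by (simp flip: measure_pmf.emeasure_eq_measure add: emeasure_bind_pmf)
       (simp add: measure_pmf.emeasure_eq_measure ennreal_mult ennreal_plus mult.commute)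
  then show ?thesis
    using assms by (subst (asm) ennreal_inj) auto
qed

text \<open>The event on the right forces \<open>e\<close> in, so it depends only on the rest of
  \<open>G\<close> and is independent of \<open>e \<in> G\<close>. Being an identity for arbitrary
  \<open>Z\<close>, it treats decreasing events exactly.\<close>

lemma prob_random_subset_insert:
  assumes "finite P" "e \<in> P" "0 \<le> q" "q \<le> 1"
  shows "measure_pmf.prob (random_subset P q) {G. e \<in> G \<and> G \<in> Z} =
    q * measure_pmf.prob (random_subset P q) {G. insert e G \<in> Z}"
proof -
  define P' where "P' = P - {e}"
  have P: "P = insert e P'" "finite P'" "e \<notin> P'"
    using assms by (auto simp: P'_def)
  have "measure_pmf.prob (random_subset P' q) {G. e \<in> G \<and> G \<in> Z} = 0"
    using set_pmf_random_subset[of P' q] P(3) by (auto simp: measure_pmf_zero_iff)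
  then show ?thesis
    unfolding P(1) random_subset_insert[OF P(2,3)]
    using assms by (simp add: measure_bind_bernoulli vimage_def algebra_simps)
qed

lemma prob_random_subset_union:
  assumes "finite P" "E \<subseteq> P" "0 \<le> q" "q \<le> 1"
  shows "measure_pmf.prob (random_subset P q) {G. E \<subseteq> G \<and> G \<in> Z} =
    q ^ card E * measure_pmf.prob (random_subset P q) {G. G \<union> E \<in> Z}"
proof -
  have "finite E"
    using assms finite_subset by blast
  then show ?thesis
    using \<open>E \<subseteq> P\<close>
  proof (induction E arbitrary: Z)
    case empty
    then show ?case by simp
  next
    case (insert e E)
    have "measure_pmf.prob (random_subset P q) {G. insert e E \<subseteq> G \<and> G \<in> Z} =
      measure_pmf.prob (random_subset P q) {G. e \<in> G \<and> G \<in> {G. E \<subseteq> G \<and> G \<in> Z}}"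
      by simp
    also have "\<dots> = q * measure_pmf.prob (random_subset P q) {G. E \<subseteq> G \<and> G \<in> {G. insert e G \<in> Z}}"
      using insert.prems insert.hyps assms
      by (subst prob_random_subset_insert) (auto intro!: arg_cong[where f="measure_pmf.prob _"])
    also have "\<dots> = q * (q ^ card E * measure_pmf.prob (random_subset P q) {G. G \<union> E \<in> {G. insert e G \<in> Z}})"
      using insert.prems by (subst insert.IH) auto
    finally show ?case
      using insert.hyps by simp
  qed
qed

lemma prob_random_subset_superset:
  assumes "finite P" "E \<subseteq> P" "0 \<le> q" "q \<le> 1"
  shows "measure_pmf.prob (random_subset P q) {G. E \<subseteq> G} = q ^ card E"
  using prob_random_subset_union[OF assms, of UNIV] by simp

subsection \<open>The sequential coupling\<close>

text \<open>\<open>Y\<close> lists the events known to have occurred and \<open>N\<close> those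
  known to have failed. An index whose exposure yielded no information lies in neither set.\<close>

definition conditioning :: "('b \<Rightarrow> 'a set) \<Rightarrow> 'b set \<Rightarrow> 'b set \<Rightarrow> 'a set" where
  "conditioning A Y N = {G. (\<forall>y\<in>Y. G \<in> A y) \<and> (\<forall>y\<in>N. G \<notin> A y)}"

lemma conditioning_insert:
  "conditioning A (insert i Y) N = conditioning A Y N \<inter> A i"
  "conditioning A Y (insert i N) = conditioning A Y N - A i"
  by (auto simp: conditioning_def)

lemma measure_cond_pmf:
  assumes "set_pmf p \<inter> s \<noteq> {}"
  shows "measure_pmf.prob (cond_pmf p s) t = measure_pmf.prob p (s \<inter> t) / measure_pmf.prob p s"
  using emeasure_measure_pmf_not_zero[OF assms]
  by (simp add: cond_pmf.rep_eq[OF assms] measure_pmf.emeasure_eq_measure)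

text \<open>Perform a test with probability \<open>q / c\<close>; it succeeds if the sample also
  lies in \<open>A\<close>, hence with probability \<open>q\<close>. Then \<open>w\<close> is the
  conditional probability, given no success, that the test was performed and failed:
  \<open>(q / c) * (1 - c)\<close> divided by \<open>1 - q\<close>. In the remaining case nothing is
  learned and the law stays \<open>cond_pmf \<mu> C\<close>.\<close>

lemma cond_pmf_bernoulli_mixture:
  fixes \<mu> :: "'a pmf" and C A :: "'a set" and q :: real
  defines "c \<equiv> measure_pmf.prob (cond_pmf \<mu> C) A"
  defines "w \<equiv> q * (1 - c) / (c * (1 - q))"
  assumes C: "set_pmf \<mu> \<inter> C \<noteq> {}" and q: "0 < q" "q \<le> c" "c < 1"
  shows "0 \<le> w" "w \<le> 1" "set_pmf \<mu> \<inter> (C \<inter> A) \<noteq> {}" "set_pmf \<mu> \<inter> (C - A) \<noteq> {}"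
    "bernoulli_pmf q \<bind> (\<lambda>b. if b then cond_pmf \<mu> (C \<inter> A)
       else bernoulli_pmf w \<bind> (\<lambda>b. if b then cond_pmf \<mu> (C - A) else cond_pmf \<mu> C)) =
     cond_pmf \<mu> C"
proof -
  define m where "m = measure_pmf.prob \<mu> C"
  define m1 where "m1 = measure_pmf.prob \<mu> (C \<inter> A)"
  have m: "m > 0"
    using C by (auto simp: m_def intro: measure_pmf_posI)
  have c: "c = m1 / m"
    using C by (simp add: c_def m1_def m_def measure_cond_pmf)
  have m2: "measure_pmf.prob \<mu> (C - A) = m - m1"
    unfolding m_def m1_def by (subst measure_pmf.finite_measure_Diff'[symmetric]) auto
  have m1: "0 < m1" "m1 < m"
    using q m by (auto simp: c field_simps intro: mult_pos_pos less_le_trans)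
  show w: "0 \<le> w" 
    using q by (auto simp: w_def)
  have "q * (1 - c) \<le> c * (1 - q)"
    using q by (simp add: algebra_simps)
  then show w1: "w \<le> 1"
    using q by (simp add: w_def divide_le_eq)
  show 1: "set_pmf \<mu> \<inter> (C \<inter> A) \<noteq> {}"
    using m1(1) by (auto simp: m1_def measure_pmf_zero_iff zero_less_measure_iff)
  show 2: "set_pmf \<mu> \<inter> (C - A) \<noteq> {}"
    using m2 m1(2) by (metis diff_gt_0_iff_gt less_numeral_extra(3) measure_pmf_zero_iff)
  have "(1 - q) * w = q * (1 - c) / c"
    using q by (simp add: w_def)
  then have e1: "(1 - q) * w = q * (m - m1) / m1"
    using m m1 by (simp only: c) (simp add: divide_simps)
  \<comment> \<open>As \<open>m / m1 = 1 / c\<close>, this is the probability that no test is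
    performed.\<close>
  then have e2: "(1 - q) * (1 - w) = 1 - q * m / m1"
    using m1 by (simp add: algebra_simps diff_divide_distrib)
  show "bernoulli_pmf q \<bind> (\<lambda>b. if b then cond_pmf \<mu> (C \<inter> A)
       else bernoulli_pmf w \<bind> (\<lambda>b. if b then cond_pmf \<mu> (C - A) else cond_pmf \<mu> C)) =
     cond_pmf \<mu> C"
  proof (rule pmf_eqI)
    fix x
    have "pmf (bernoulli_pmf q \<bind> (\<lambda>b. if b then cond_pmf \<mu> (C \<inter> A)
       else bernoulli_pmf w \<bind> (\<lambda>b. if b then cond_pmf \<mu> (C - A) else cond_pmf \<mu> C))) x =
      q * pmf (cond_pmf \<mu> (C \<inter> A)) x + ((1 - q) * w) * pmf (cond_pmf \<mu> (C - A)) x +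
      ((1 - q) * (1 - w)) * pmf (cond_pmf \<mu> C) x"
      using w w1 q by (simp add: pmf_bind_bernoulli algebra_simps)
    also have "\<dots> = pmf (cond_pmf \<mu> C) x"
      unfolding e1 e2 pmf_cond[OF 1] pmf_cond[OF 2] pmf_cond[OF C] m2 m_def[symmetric] m1_def[symmetric]
      using m m1 by (auto simp: field_simps)
    finally show "pmf (bernoulli_pmf q \<bind> (\<lambda>b. if b then cond_pmf \<mu> (C \<inter> A)
       else bernoulli_pmf w \<bind> (\<lambda>b. if b then cond_pmf \<mu> (C - A) else cond_pmf \<mu> C))) x =
       pmf (cond_pmf \<mu> C) x" .
  qed
qed

text \<open>Covers conditional probability one, where \<open>C - A\<close> carries no mass and
  cannot be conditioned on: \<open>A\<close> already holds almost surely, so revealing it changes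
  nothing.\<close>

lemma cond_pmf_Int_eq:
  assumes "set_pmf \<mu> \<inter> C \<noteq> {}" "measure_pmf.prob (cond_pmf \<mu> C) A = 1"
  shows "set_pmf \<mu> \<inter> (C \<inter> A) \<noteq> {}" "cond_pmf \<mu> (C \<inter> A) = cond_pmf \<mu> C"
proof -
  have sub: "set_pmf \<mu> \<inter> C \<subseteq> A"
    using assms measure_pmf.prob_eq_1[of A "cond_pmf \<mu> C"] by (auto simp: AE_measure_pmf_iff)
  then show 1: "set_pmf \<mu> \<inter> (C \<inter> A) \<noteq> {}"
    using assms(1) by blast
  have "measure_pmf.prob \<mu> (C \<inter> A) = measure_pmf.prob \<mu> C"
    using sub by (intro measure_prob_cong_0) (auto simp: pmf_eq_0_set_pmf)
  then show "cond_pmf \<mu> (C \<inter> A) = cond_pmf \<mu> C"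
    using sub by (intro pmf_eqI) (auto simp: pmf_cond[OF 1] pmf_cond[OF assms(1)] pmf_eq_0_set_pmf)
qed

text \<open>The hyperedges are exposed one at a time. Given what has been revealed about \<open>G\<close>, namely that
  \<open>G \<in> conditioning A Y N\<close>, the event \<open>A i\<close> has some conditional probability \<open>c\<close>. If \<open>c \<ge> q\<close>, test
  \<open>A i\<close> with probability \<open>q / c\<close> and put \<open>i\<close> into \<open>H\<close> if the test succeeds. If \<open>c < q\<close>, put \<open>i\<close>
  into \<open>H\<close> by an independent coin of bias \<open>q\<close>; only in this case can \<open>A i\<close> fail for a member of \<open>H\<close>.\<close>

lemma sequential_coupling:
  fixes \<mu> :: "'a pmf" and A :: "'b \<Rightarrow> 'a set"
  assumes "finite D" "0 \<le> q" "q \<le> 1" "set_pmf \<mu> \<inter> conditioning A Y N \<noteq> {}"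
  shows "\<exists>J. map_pmf fst J = cond_pmf \<mu> (conditioning A Y N) \<and> map_pmf snd J = random_subset D q \<and>
    (\<forall>(G, H) \<in> set_pmf J. (\<forall>h\<in>H. G \<in> A h) \<or>
      (\<exists>j\<in>H. \<exists>Y' N'. Y' \<subseteq> Y \<union> (H - {j}) \<and> N' \<subseteq> N \<union> (D - H) \<and>
         set_pmf \<mu> \<inter> conditioning A Y' N' \<noteq> {} \<and>
         measure_pmf.prob (cond_pmf \<mu> (conditioning A Y' N')) (A j) < q))"
proof -
  define ok where "ok D Y N G H \<longleftrightarrow> (\<forall>h\<in>H. G \<in> A h) \<or>
      (\<exists>j\<in>H. \<exists>Y' N'. Y' \<subseteq> Y \<union> (H - {j}) \<and> N' \<subseteq> N \<union> (D - H) \<and>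
         set_pmf \<mu> \<inter> conditioning A Y' N' \<noteq> {} \<and>
         measure_pmf.prob (cond_pmf \<mu> (conditioning A Y' N')) (A j) < q)" for D Y N G H
  \<comment> \<open>The ranges for \<open>Y'\<close> and \<open>N'\<close> may grow, and
    \<open>H\<close> may gain members whose events hold. This transfers the induction hypothesis
    when \<open>i\<close> moves from \<open>insert i Y\<close> into \<open>H\<close>, or from
    \<open>insert i N\<close> into the complement of \<open>H\<close>.\<close>
  have ok_weaken: "ok D' Y' N' G H'"
    if ok: "ok D Y N G H" and "H \<subseteq> H'" "\<forall>h\<in>H' - H. G \<in> A h" "N \<union> (D - H) \<subseteq> N' \<union> (D' - H')"
      and Y: "\<And>j. j \<in> H \<Longrightarrow> Y \<union> (H - {j}) \<subseteq> Y' \<union> (H' - {j})"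
    for D D' Y Y' N N' G H H'
  proof (cases "\<forall>h\<in>H. G \<in> A h")
    case True
    then show ?thesis
      using that(3) by (auto simp: ok_def)
  next
    case False
    then obtain j Y1 N1 where j: "j \<in> H" "Y1 \<subseteq> Y \<union> (H - {j})" "N1 \<subseteq> N \<union> (D - H)"
      "set_pmf \<mu> \<inter> conditioning A Y1 N1 \<noteq> {}"
      "measure_pmf.prob (cond_pmf \<mu> (conditioning A Y1 N1)) (A j) < q"
      using ok unfolding ok_def by blast
    have "j \<in> H'" "Y1 \<subseteq> Y' \<union> (H' - {j})" "N1 \<subseteq> N' \<union> (D' - H')"
      using j(1-3) that(2,4) Y[OF j(1)] by (blast, order, order)
    then show ?thesis
      unfolding ok_def using j(4,5) by blast
  qed
  have "\<exists>J. map_pmf fst J = cond_pmf \<mu> (conditioning A Y N) \<and> map_pmf snd J = random_subset D q \<and>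
    (\<forall>(G, H) \<in> set_pmf J. ok D Y N G H)"
    using assms(1,4)
  \<comment> \<open>The element \<open>i\<close> is the one exposed first; \<open>Y\<close> and
    \<open>N\<close> are arbitrary because the rest of \<open>D\<close> is coupled under the updated
    information.\<close>
  proof (induction D arbitrary: Y N)
    case empty
    show ?case
      by (rule exI[of _ "map_pmf (\<lambda>G. (G, {})) (cond_pmf \<mu> (conditioning A Y N))"])
         (auto simp: map_pmf_comp random_subset_empty ok_def)
  next
    case (insert i D)
    define C where "C = conditioning A Y N"
    define c where "c = measure_pmf.prob (cond_pmf \<mu> C) (A i)"
    have C: "set_pmf \<mu> \<inter> C \<noteq> {}"
      using insert.prems by (simp add: C_def)
    have sub: "H \<subseteq> D" if "map_pmf snd J = random_subset D q" "(G, H) \<in> set_pmf J"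
      for G H and J :: "('a \<times> 'b set) pmf"
      using that set_pmf_random_subset[of D q]
      by (metis PowD imageI set_map_pmf snd_conv subsetD)
    have ok_mono: "ok (insert i D) Y N G H" if "ok D Y N G H \<or> ok D Y (insert i N) G H" "H \<subseteq> D" for G H
      using that(1) insert.hyps that(2) by (elim disjE; elim ok_weaken) auto
    have ok_insert: "ok (insert i D) Y N G (insert i H)"
      if "ok D (insert i Y) N G H" "G \<in> A i" "H \<subseteq> D" for G H
      using that(1) by (rule ok_weaken) (use that(2,3) insert.hyps in auto)
    have mixture: ?case
      if "map_pmf snd J1 = map_pmf (insert i) (random_subset D q)"
        "map_pmf snd J2 = random_subset D q"
        "bernoulli_pmf q \<bind> (\<lambda>b. if b then map_pmf fst J1 else map_pmf fst J2) = cond_pmf \<mu> C"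
        "\<And>G H. (G, H) \<in> set_pmf J1 \<Longrightarrow> ok (insert i D) Y N G H"
        "\<And>G H. (G, H) \<in> set_pmf J2 \<Longrightarrow> ok (insert i D) Y N G H"
      for J1 J2 :: "('a \<times> 'b set) pmf"
    proof (rule exI[of _ "bernoulli_pmf q \<bind> (\<lambda>b. if b then J1 else J2)"], intro conjI)
      show "map_pmf snd (bernoulli_pmf q \<bind> (\<lambda>b. if b then J1 else J2)) = random_subset (insert i D) q"
        unfolding random_subset_insert[OF insert.hyps] map_bind_pmf
        using that(1,2) by (intro bind_pmf_cong) auto
      show "map_pmf fst (bernoulli_pmf q \<bind> (\<lambda>b. if b then J1 else J2)) = cond_pmf \<mu> (conditioning A Y N)"
        using that(3) by (simp add: map_bind_pmf C_def if_distrib cong: if_cong)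
      show "\<forall>(G, H)\<in>set_pmf (bernoulli_pmf q \<bind> (\<lambda>b. if b then J1 else J2)). ok (insert i D) Y N G H"
        using that(4,5) by (auto split: if_splits)
    qed
    let ?ins = "map_pmf (\<lambda>(G, H). (G, insert i H))"
    have ins_marg: "map_pmf snd (?ins J) = map_pmf (insert i) (map_pmf snd J)"
      "map_pmf fst (?ins J) = map_pmf fst J" for J :: "('a \<times> 'b set) pmf"
      by (auto simp: map_pmf_comp intro!: map_pmf_cong)
    obtain J3 where J3: "map_pmf fst J3 = cond_pmf \<mu> C" "map_pmf snd J3 = random_subset D q"
      "\<And>G H. (G, H) \<in> set_pmf J3 \<Longrightarrow> ok D Y N G H"
      using insert.IH[OF insert.prems] unfolding C_def by blast
    have ok3: "ok (insert i D) Y N G H" if "(G, H) \<in> set_pmf J3" for G H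
      using J3(3)[OF that] ok_mono sub[OF J3(2) that] by blast
    have hit: "\<exists>J. map_pmf fst J = cond_pmf \<mu> (C \<inter> A i) \<and>
        map_pmf snd J = map_pmf (insert i) (random_subset D q) \<and>
        (\<forall>G H. (G, H) \<in> set_pmf J \<longrightarrow> ok (insert i D) Y N G H)"
      if ne: "set_pmf \<mu> \<inter> (C \<inter> A i) \<noteq> {}"
    proof -
      obtain J where J: "map_pmf fst J = cond_pmf \<mu> (C \<inter> A i)" "map_pmf snd J = random_subset D q"
        "\<And>G H. (G, H) \<in> set_pmf J \<Longrightarrow> ok D (insert i Y) N G H"
        using insert.IH[of "insert i Y" N] ne unfolding C_def conditioning_insert by blast
      have "G \<in> A i" if "(G, H) \<in> set_pmf J" for G H
        using that J(1) set_cond_pmf[OF ne] by (metis IntD2 fst_conv imageI set_map_pmf)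
      then have "ok (insert i D) Y N G H" if "(G, H) \<in> set_pmf (?ins J)" for G H
        using that J(3) sub[OF J(2)] ok_insert by auto
      then show ?thesis
        using J(1,2) ins_marg[of J] by (intro exI[of _ "?ins J"]) auto
    qed
    \<comment> \<open>The case \<open>q = 0\<close> is separated since \<open>c\<close> may vanish
      there, and \<open>c = 1\<close> since then the event cannot fail.\<close>
    consider "c < q" | "q = 0" | "0 < q" "q \<le> c" "c = 1" | "0 < q" "q \<le> c" "c < 1"
      using assms(2) measure_pmf.prob_le_1[of "cond_pmf \<mu> C" "A i", folded c_def] by linarith
    then show ?case
    proof cases
      case 1
      \<comment> \<open>With \<open>i\<close> as witness the failure clause already holds, so
        \<open>G\<close> and the rest of \<open>H\<close> may be drawn independently from here
        on.\<close>
      define J1 where "J1 = pair_pmf (cond_pmf \<mu> C) (map_pmf (insert i) (random_subset D q))"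
      have "ok (insert i D) Y N G H" if "(G, H) \<in> set_pmf J1" for G H
        unfolding ok_def using that 1 C
        by (intro disjI2 bexI[of _ i] exI[of _ Y] exI[of _ N]) (auto simp: J1_def c_def C_def)
      moreover have "map_pmf fst J1 = cond_pmf \<mu> C"
        "map_pmf snd J1 = map_pmf (insert i) (random_subset D q)"
        by (simp_all add: J1_def map_fst_pair_pmf map_snd_pair_pmf)
      ultimately show ?thesis
        using J3(1,2) ok3 by (intro mixture[of J1 J3]) (auto cong: if_cong)
    next
      case 2
      have "random_subset (insert i D) q = random_subset D q"
        unfolding random_subset_insert[OF insert.hyps] using 2
        by (intro pmf_eqI) (simp add: pmf_bind_bernoulli)
      then show ?thesis
        using J3(1,2) ok3 unfolding C_def by (intro exI[of _ J3]) auto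
    next
      case 3
      have one: "measure_pmf.prob (cond_pmf \<mu> C) (A i) = 1"
        using 3 by (simp add: c_def)
      obtain J1 where "map_pmf fst J1 = cond_pmf \<mu> C"
        "map_pmf snd J1 = map_pmf (insert i) (random_subset D q)"
        "\<And>G H. (G, H) \<in> set_pmf J1 \<Longrightarrow> ok (insert i D) Y N G H"
        using hit[OF cond_pmf_Int_eq(1)[OF C one]] cond_pmf_Int_eq(2)[OF C one] by metis
      then show ?thesis
        using J3(1,2) ok3 by (intro mixture[of J1 J3]) (auto cong: if_cong)
    next
      case 4
      note mix = cond_pmf_bernoulli_mixture[OF C 4(1) 4(2,3)[unfolded c_def]]
      define w where "w = q * (1 - c) / (c * (1 - q))"
      obtain J1 where J1: "map_pmf fst J1 = cond_pmf \<mu> (C \<inter> A i)"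
        "map_pmf snd J1 = map_pmf (insert i) (random_subset D q)"
        "\<And>G H. (G, H) \<in> set_pmf J1 \<Longrightarrow> ok (insert i D) Y N G H"
        using hit[OF mix(3)] by metis
      obtain J2 where J2: "map_pmf fst J2 = cond_pmf \<mu> (C - A i)" "map_pmf snd J2 = random_subset D q"
        "\<And>G H. (G, H) \<in> set_pmf J2 \<Longrightarrow> ok D Y (insert i N) G H"
        using insert.IH[of Y "insert i N"] mix(4) unfolding C_def conditioning_insert by blast
      have ok2: "ok (insert i D) Y N G H" if "(G, H) \<in> set_pmf J2" for G H
        using J2(3)[OF that] ok_mono sub[OF J2(2) that] by blast
      \<comment> \<open>The index \<open>i\<close> stays out of \<open>H\<close>: with probability
        \<open>w\<close> its event is recorded as failed, otherwise the information is
        unchanged.\<close>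
      define J23 where "J23 = bernoulli_pmf w \<bind> (\<lambda>b. if b then J2 else J3)"
      have "map_pmf snd J23 = random_subset D q"
        unfolding J23_def map_bind_pmf using J2(2) J3(2) by (simp add: if_distrib cong: if_cong)
      moreover have "map_pmf fst J23 =
        bernoulli_pmf w \<bind> (\<lambda>b. if b then cond_pmf \<mu> (C - A i) else cond_pmf \<mu> C)"
        unfolding J23_def map_bind_pmf using J2(1) J3(1) by (simp add: if_distrib cong: if_cong)
      moreover have "ok (insert i D) Y N G H" if "(G, H) \<in> set_pmf J23" for G H
        using that ok2 ok3 by (auto simp: J23_def split: if_splits)
      ultimately show ?thesis
        using J1 mix(5) by (intro mixture[of J1 J23]) (auto simp: w_def c_def cong: if_cong)
    qed
  qed
  then show ?thesis
    unfolding ok_def .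
qed

subsection \<open>Conditional probabilities of cliques\<close>

text \<open>Once \<open>R\<close> is present, only those \<open>i\<close> in \<open>N\<close> whose
  \<open>E i\<close> meets \<open>E j\<close> outside \<open>R\<close> can interact with
  \<open>A j\<close>. Ignoring them leaves a decreasing event \<open>D0\<close> under which
  \<open>A j\<close> costs exactly the factor \<open>p ^ card (E j - R)\<close>; restoring them by
  the union bound loses at most the proportion \<open>Q\<close>.\<close>

lemma cond_prob_superset_lower_bound:
  fixes E :: "'b \<Rightarrow> 'a set" and P :: "'a set" and p :: real
  defines "\<mu> \<equiv> random_subset P p" and "A \<equiv> (\<lambda>i. {G. E i \<subseteq> G})"
  assumes P: "finite P" and p: "0 \<le> p" "p \<le> 1" and "finite N"
    and E: "E j \<subseteq> P" "\<And>i. i \<in> N \<Longrightarrow> E i \<subseteq> P"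
    and ne: "set_pmf \<mu> \<inter> conditioning A Y N \<noteq> {}"
  defines "R \<equiv> \<Union> (E ` Y)"
  defines "Q \<equiv> (\<Sum>i | i \<in> N \<and> E i \<inter> E j - R \<noteq> {}. p ^ card (E i - (E j \<union> R)))"
  shows "p ^ card (E j - R) * (1 - Q) \<le> measure_pmf.prob (cond_pmf \<mu> (conditioning A Y N)) (A j)"
proof (cases "Q \<le> 1")
  case False
  then have "p ^ card (E j - R) * (1 - Q) \<le> 0"
    using p by (simp add: mult_nonneg_nonpos)
  then show ?thesis
    using measure_nonneg order_trans by blast
next
  case True
  let ?M = "measure_pmf.prob \<mu>"
  define N1 where "N1 = {i \<in> N. E i \<inter> E j - R \<noteq> {}}"
  define D0 where "D0 = {G. \<forall>i\<in>N - N1. \<not> E i \<subseteq> G}"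
  define f where "f = ?M {G. R \<subseteq> G \<and> G \<in> D0}"
  have C: "conditioning A Y N = {G. R \<subseteq> G \<and> (\<forall>i\<in>N. \<not> E i \<subseteq> G)}"
    by (auto simp: conditioning_def A_def R_def)
  have union: "?M {G. F \<union> R \<subseteq> G \<and> G \<in> D0} = p ^ card (F - R) * ?M {G. R \<subseteq> G \<and> G \<union> F \<in> D0}"
    if "F \<subseteq> P" for F
  proof -
    have "?M {G. F \<union> R \<subseteq> G \<and> G \<in> D0} = ?M {G. F - R \<subseteq> G \<and> G \<in> {G. R \<subseteq> G \<and> G \<in> D0}}"
      by (rule arg_cong[where f="?M"]) auto
    also have "\<dots> = p ^ card (F - R) * ?M {G. G \<union> (F - R) \<in> {G. R \<subseteq> G \<and> G \<in> D0}}"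
      unfolding \<mu>_def using that P p by (intro prob_random_subset_union) auto
    also have "{G. G \<union> (F - R) \<in> {G. R \<subseteq> G \<and> G \<in> D0}} = {G. R \<subseteq> G \<and> G \<union> F \<in> D0}"
    proof -
      have "R \<subseteq> G \<union> (F - R) \<longleftrightarrow> R \<subseteq> G" "R \<subseteq> G \<Longrightarrow> G \<union> (F - R) = G \<union> F" for G
        by blast+
      then show ?thesis
        unfolding mem_Collect_eq by (intro Collect_cong) metis
    qed
    finally show ?thesis .
  qed
  \<comment> \<open>\<open>D0\<close> is decreasing, so forcing further elements into
    \<open>G\<close> can only lower its probability. This is the form in which Harris' inequality
    enters.\<close>
  have upper: "?M {G. E i \<union> E j \<union> R \<subseteq> G \<and> G \<in> D0} \<le> p ^ card (E j - R) * p ^ card (E i - (E j \<union> R)) * f"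
    if i: "i \<in> N1" for i
  proof -
    have F: "E i \<union> E j \<subseteq> P"
      using i E by (auto simp: N1_def)
    then have fin: "finite (E i)" "finite (E j)"
      using P finite_subset by blast+
    have "card (E i \<union> E j - R) = card ((E j - R) \<union> (E i - (E j \<union> R)))"
      by (rule arg_cong[where f=card]) auto
    also have "\<dots> = card (E j - R) + card (E i - (E j \<union> R))"
      using fin by (intro card_Un_disjoint) auto
    moreover have "?M {G. R \<subseteq> G \<and> G \<union> (E i \<union> E j) \<in> D0} \<le> f"
      unfolding f_def D0_def by (intro measure_pmf.finite_measure_mono) auto
    ultimately show ?thesis
      unfolding union[OF F] using p by (simp add: power_add mult_left_mono)
  qed
  have exact: "?M {G. E j \<union> R \<subseteq> G \<and> G \<in> D0} = p ^ card (E j - R) * f"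
  proof -
    \<comment> \<open>For \<open>i\<close> outside \<open>N1\<close> the set \<open>E i\<close>
      meets \<open>E j\<close> only inside \<open>R\<close>, which \<open>G\<close> already
      contains.\<close>
    have "G \<union> E j \<in> D0 \<longleftrightarrow> G \<in> D0" if "R \<subseteq> G" for G
      using that by (auto simp: D0_def N1_def) blast+
    then have "{G. R \<subseteq> G \<and> G \<union> E j \<in> D0} = {G. R \<subseteq> G \<and> G \<in> D0}"
      by auto
    then show ?thesis
      unfolding union[OF E(1)] f_def by simp
  qed
  have finN1: "finite N1"
    using \<open>finite N\<close> by (simp add: N1_def)
  have "{G. E j \<union> R \<subseteq> G \<and> G \<in> D0} \<subseteq>
    (conditioning A Y N \<inter> A j) \<union> (\<Union>i\<in>N1. {G. E i \<union> E j \<union> R \<subseteq> G \<and> G \<in> D0})"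
    unfolding C by (auto simp: A_def D0_def)
  then have "?M {G. E j \<union> R \<subseteq> G \<and> G \<in> D0} \<le>
    ?M ((conditioning A Y N \<inter> A j) \<union> (\<Union>i\<in>N1. {G. E i \<union> E j \<union> R \<subseteq> G \<and> G \<in> D0}))"
    by (rule measure_pmf.finite_measure_mono) auto
  also have "\<dots> \<le> ?M (conditioning A Y N \<inter> A j) + ?M (\<Union>i\<in>N1. {G. E i \<union> E j \<union> R \<subseteq> G \<and> G \<in> D0})"
    by (rule measure_Un_le) auto
  also have "?M (\<Union>i\<in>N1. {G. E i \<union> E j \<union> R \<subseteq> G \<and> G \<in> D0}) \<le>
    (\<Sum>i\<in>N1. ?M {G. E i \<union> E j \<union> R \<subseteq> G \<and> G \<in> D0})"
    using finN1 by (intro measure_pmf.finite_measure_subadditive_finite) auto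
  also have "\<dots> \<le> (\<Sum>i\<in>N1. p ^ card (E j - R) * p ^ card (E i - (E j \<union> R)) * f)"
    by (intro sum_mono upper)
  also have "\<dots> = p ^ card (E j - R) * Q * f"
    by (simp add: Q_def N1_def sum_distrib_left sum_distrib_right)
  finally have lower: "p ^ card (E j - R) * (1 - Q) * f \<le> ?M (conditioning A Y N \<inter> A j)"
    unfolding exact by (simp add: algebra_simps)
  have "?M (conditioning A Y N) \<le> f"
    unfolding f_def C D0_def by (intro measure_pmf.finite_measure_mono) auto
  then have "p ^ card (E j - R) * (1 - Q) * ?M (conditioning A Y N) \<le> p ^ card (E j - R) * (1 - Q) * f"
    using p True by (intro mult_left_mono) auto
  with lower have "p ^ card (E j - R) * (1 - Q) * ?M (conditioning A Y N) \<le> ?M (conditioning A Y N \<inter> A j)"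
    by linarith
  moreover have "?M (conditioning A Y N) > 0"
    using ne by (auto intro: measure_pmf_posI)
  ultimately show ?thesis
    using ne by (simp add: measure_cond_pmf field_simps)
qed

subsection \<open>Sets overlapping a hyperedge\<close>

definition pairs :: "'a set \<Rightarrow> 'a set set" where
  "pairs X = {e. e \<subseteq> X \<and> card e = 2}"

definition shadow :: "'a set set \<Rightarrow> 'a set set" where
  "shadow H = \<Union> (pairs ` H)"

text \<open>The graph \<open>shadow H\<close> as a relation, with an added loop at every vertex
  covered by \<open>H\<close>.\<close>

definition adj :: "'a set set \<Rightarrow> ('a \<times> 'a) set" where
  "adj H = {(x, y). \<exists>g\<in>H. x \<in> g \<and> y \<in> g}"

lemma doubleton_in_pairs: "{x, y} \<in> pairs X \<longleftrightarrow> x \<in> X \<and> y \<in> X \<and> x \<noteq> y"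
  by (auto simp: pairs_def card_insert_if)

lemma pairsE:
  assumes "e \<in> pairs X"
  obtains x y where "e = {x, y}" "x \<in> X" "y \<in> X" "x \<noteq> y"
  using assms by (auto simp: pairs_def card_2_iff)

lemma finite_pairs: "finite X \<Longrightarrow> finite (pairs X)"
  by (rule finite_subset[of _ "Pow X"]) (auto simp: pairs_def)

lemma card_pairs: "finite X \<Longrightarrow> card (pairs X) = card X choose 2"
  by (simp add: pairs_def n_subsets)

lemma doubleton_in_shadow: "{x, y} \<in> shadow H \<longleftrightarrow> x \<noteq> y \<and> (x, y) \<in> adj H"
  by (auto simp: shadow_def adj_def doubleton_in_pairs)

lemma sym_adj: "sym (adj H)"
  by (auto simp: adj_def sym_def)

section \<open>Transversals of components and balls in the shadow graph\<close>

lemma transversal_exists: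
  assumes "finite X" "v \<in> X" "sym S"
  obtains T where "T \<subseteq> X" "v \<in> T" "X \<subseteq> (S \<inter> X \<times> X)\<^sup>* `` T"
    "\<And>u t t'. u \<in> X \<Longrightarrow> t \<in> T \<Longrightarrow> t' \<in> T \<Longrightarrow> u = t \<or> (u, t) \<in> S \<Longrightarrow> u = t' \<or> (u, t') \<in> S \<Longrightarrow> t = t'"
proof -
  define R where "R = S \<inter> X \<times> X"
  define spanning where "spanning T \<longleftrightarrow> T \<subseteq> X \<and> v \<in> T \<and> X \<subseteq> R\<^sup>* `` T" for T
  have "spanning X"
    using assms by (auto simp: spanning_def)
  then obtain T where T: "spanning T" "\<And>T'. spanning T' \<Longrightarrow> card T \<le> card T'"
    using exists_least_iff[of "\<lambda>k. \<exists>T. spanning T \<and> card T = k"] by (metis not_le)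
  have TX: "T \<subseteq> X" "v \<in> T" "X \<subseteq> R\<^sup>* `` T" and finT: "finite T"
    using T(1) assms(1) finite_subset by (auto simp: spanning_def)
  have symR: "sym R"
    using assms(3) by (auto simp: R_def sym_def)
  \<comment> \<open>The removed element must differ from \<open>v\<close>, which has to stay in
    \<open>T\<close>. At most one of two elements is \<open>v\<close>, so the claim is used in both
    directions below.\<close>
  have *: False if "t \<in> T" "t' \<in> T" "t \<noteq> t'" "t' \<noteq> v" "(t, t') \<in> R\<^sup>*" for t t'
  proof -
    have "X \<subseteq> R\<^sup>* `` (T - {t'})"
    proof
      fix x assume "x \<in> X"
      then obtain s where s: "s \<in> T" "(s, x) \<in> R\<^sup>*"
        using TX by auto
      show "x \<in> R\<^sup>* `` (T - {t'})"
      proof (cases "s = t'")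
        case True
        then have "(t, x) \<in> R\<^sup>*"
          using s that(5) by (meson rtrancl_trans)
        then show ?thesis using that by auto
      qed (use s in auto)
    qed
    then have "spanning (T - {t'})"
      using TX that by (auto simp: spanning_def)
    then have "card T \<le> card (T - {t'})"
      by (rule T(2))
    then show False
      using that(2) finT by (metis card_Diff1_less not_le)
  qed
  have "t = t'" if "u \<in> X" "t \<in> T" "t' \<in> T" "u = t \<or> (u, t) \<in> S" "u = t' \<or> (u, t') \<in> S" for u t t'
  proof (rule ccontr)
    assume "t \<noteq> t'"
    have "(u, t) \<in> R\<^sup>*" "(u, t') \<in> R\<^sup>*"
      using that TX(1) by (auto simp: R_def)
    moreover have "(t, u) \<in> R\<^sup>*" "(t', u) \<in> R\<^sup>*"
      using calculation sym_rtrancl[OF symR] by (auto dest: symD)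
    ultimately have "(t, t') \<in> R\<^sup>*" "(t', t) \<in> R\<^sup>*"
      by (auto intro: rtrancl_trans)
    then show False
      using *[of t t'] *[of t' t] that \<open>t \<noteq> t'\<close> by metis
  qed
  then show ?thesis
    using that[of T] TX unfolding R_def by blast
qed

text \<open>Loops pad a short walk to length exactly \<open>k\<close>, so a ball can be written as
  the image under a single relation power.\<close>

lemma relpow_Id_extend:
  assumes "(x, y) \<in> S ^^ n" "n \<le> k"
  shows "(x, y) \<in> (Id \<union> S) ^^ k"
  using assms(2,1)
proof (induction k arbitrary: y rule: dec_induct)
  case base
  then show ?case
  proof (induction n arbitrary: y)
    case (Suc n)
    then show ?case by auto
  qed simp
next
  case (step k)
  then show ?case by auto
qed

lemma relpow_mono:
  fixes R S :: "('a \<times> 'a) set"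
  assumes "R \<subseteq> S"
  shows "R ^^ k \<subseteq> S ^^ k"
  using assms by (induction k) auto

lemma card_relpow_Image:
  fixes R :: "('a \<times> 'a) set"
  assumes "\<And>x. finite (R `` {x}) \<and> card (R `` {x}) \<le> d" "finite T"
  shows "finite ((R ^^ k) `` T) \<and> card ((R ^^ k) `` T) \<le> card T * d ^ k"
proof (induction k)
  case 0
  have "(R ^^ 0) `` T = T"
    by auto
  then show ?case using assms(2) by simp
next
  case (Suc k)
  let ?B = "(R ^^ k) `` T"
  have eq: "(R ^^ Suc k) `` T = (\<Union>x\<in>?B. R `` {x})"
    by auto
  have "card ((R ^^ Suc k) `` T) \<le> (\<Sum>x\<in>?B. card (R `` {x}))"
    unfolding eq using Suc by (intro card_UN_le) auto
  also have "\<dots> \<le> card ?B * d"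
    using assms(1) sum_bounded_above[of ?B "\<lambda>x. card (R `` {x})" d] by simp
  also have "\<dots> \<le> card T * d ^ k * d"
    using Suc by (intro mult_right_mono) auto
  finally show ?case
    unfolding eq using Suc assms(1) by (simp add: mult.assoc mult.commute[of d])
qed

text \<open>No pair inside \<open>T\<close> is in the shadow, and each vertex of
  \<open>X - T\<close> has at most one neighbour in \<open>T\<close>. With
  \<open>a = card X - card T\<close> this leaves at most \<open>(a choose 2) + a\<close> shadow
  pairs, which is \<open>Suc a choose 2\<close>.\<close>

lemma card_shadow_pairs_le:
  assumes "finite X" "T \<subseteq> X"
    and T: "\<And>u t t'. u \<in> X \<Longrightarrow> t \<in> T \<Longrightarrow> t' \<in> T \<Longrightarrow> u = t \<or> (u, t) \<in> adj H \<Longrightarrow>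
      u = t' \<or> (u, t') \<in> adj H \<Longrightarrow> t = t'"
  shows "card (pairs X \<inter> shadow H) \<le> Suc (card X - card T) choose 2"
proof -
  \<comment> \<open>For \<open>u\<close> without a neighbour in \<open>T\<close> the value is
    arbitrary, which is harmless in an upper bound.\<close>
  define F where "F = (\<lambda>u. {u, THE t. t \<in> T \<and> (u, t) \<in> adj H})"
  have "pairs X \<inter> shadow H \<subseteq> pairs (X - T) \<union> F ` (X - T)"
  proof
    fix e assume e: "e \<in> pairs X \<inter> shadow H"
    then obtain x y where xy: "e = {x, y}" "x \<in> X" "y \<in> X" "x \<noteq> y"
      by (auto elim: pairsE)
    have adj: "(x, y) \<in> adj H" "(y, x) \<in> adj H"
      using e sym_adj[of H] unfolding xy by (auto simp: doubleton_in_shadow dest: symD)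
    have F: "F u = {u, t}" if "u \<in> X" "t \<in> T" "(u, t) \<in> adj H" for u t
    proof -
      have "(THE t. t \<in> T \<and> (u, t) \<in> adj H) = t"
        using that T by (intro the_equality) blast+
      then show ?thesis by (simp add: F_def)
    qed
    consider "x \<notin> T" "y \<notin> T" | "x \<in> T" "y \<in> T" | "x \<in> T" "y \<notin> T" | "x \<notin> T" "y \<in> T"
      by blast
    then show "e \<in> pairs (X - T) \<union> F ` (X - T)"
    proof cases
      case 1
      then show ?thesis using xy by (auto simp: doubleton_in_pairs)
    next
      case 2
      then show ?thesis using T[of x x y] adj xy by blast
    next
      case 3
      then have "e = F y"
        using F[of y x] adj xy by auto
      then show ?thesis using 3 xy by auto
    next
      case 4
      then have "e = F x"
        using F[of x y] adj xy by auto
      then show ?thesis using 4 xy by auto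
    qed
  qed
  then have "card (pairs X \<inter> shadow H) \<le> card (pairs (X - T) \<union> F ` (X - T))"
    using assms(1) by (intro card_mono) (auto simp: finite_pairs)
  also have "\<dots> \<le> card (pairs (X - T)) + card (F ` (X - T))"
    by (rule card_Un_le)
  also have "\<dots> \<le> (card (X - T) choose 2) + card (X - T)"
    using assms(1) by (simp add: card_pairs card_image_le)
  also have "\<dots> = Suc (card X - card T) choose 2"
    using assms(1,2) by (simp add: card_Diff_subset finite_subset numeral_2_eq_2)
  finally show ?thesis .
qed

lemma card_supersets_le:
  assumes "finite V" "finite B" "card B \<le> k"
  shows "card {X. B \<subseteq> X \<and> X \<subseteq> V \<and> card X = k} \<le> card V ^ (k - card B)"
proof -
  have "card {X. B \<subseteq> X \<and> X \<subseteq> V \<and> card X = k} \<le> card {Y. Y \<subseteq> V \<and> card Y = k - card B}"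
  proof (rule card_inj_on_le)
    show "inj_on (\<lambda>X. X - B) {X. B \<subseteq> X \<and> X \<subseteq> V \<and> card X = k}"
      by (rule inj_onI) blast
    show "(\<lambda>X. X - B) ` {X. B \<subseteq> X \<and> X \<subseteq> V \<and> card X = k} \<subseteq> {Y. Y \<subseteq> V \<and> card Y = k - card B}"
      using assms(2) by (auto simp: card_Diff_subset)
    show "finite {Y. Y \<subseteq> V \<and> card Y = k - card B}"
      using assms(1) by simp
  qed
  also have "\<dots> = card V choose (k - card B)"
    using assms(1) by (rule n_subsets)
  also have "\<dots> \<le> card V ^ (k - card B)"
    by (cases "k - card B \<le> card V") (auto simp: binomial_le_pow binomial_eq_0)
  finally show ?thesis .
qed

lemma finite_possible_hyperedges: "finite (possible_hyperedges r n)"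
  by (simp add: possible_hyperedges_def)

lemma sum_Sigma_Pair:
  assumes "finite A" "\<And>x. x \<in> A \<Longrightarrow> finite (B x)"
  shows "sum g (Sigma A B) = (\<Sum>x\<in>A. \<Sum>y\<in>B x. g (x, y))"
  using assms by (simp add: sum.Sigma)

lemma card_adj_Image:
  assumes "\<And>v. card {g \<in> H. v \<in> g} \<le> D" "finite H" "\<And>g. g \<in> H \<Longrightarrow> finite g \<and> card g = r"
  shows "finite ((Id \<union> adj H) `` {x}) \<and> card ((Id \<union> adj H) `` {x}) \<le> 1 + D * r"
proof -
  have eq: "(Id \<union> adj H) `` {x} = insert x (\<Union>g\<in>{g \<in> H. x \<in> g}. g)"
    by (auto simp: adj_def)
  have "card (\<Union>g\<in>{g \<in> H. x \<in> g}. g) \<le> (\<Sum>g\<in>{g \<in> H. x \<in> g}. card g)"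
    using assms(2) by (intro card_UN_le) auto
  also have "\<dots> \<le> D * r"
    using assms(1)[of x] assms(3) by simp
  finally have "card (\<Union>g\<in>{g \<in> H. x \<in> g}. g) \<le> D * r" .
  moreover have "finite (\<Union>g\<in>{g \<in> H. x \<in> g}. g)"
    using assms(2,3) by auto
  ultimately have "card (insert x (\<Union>g\<in>{g \<in> H. x \<in> g}. g)) \<le> 1 + D * r"
    by (simp add: card_insert_if)
  then show ?thesis
    unfolding eq using assms(2,3) by auto
qed

text \<open>If \<open>X\<close> has \<open>c\<close> components in the graph \<open>shadow H\<close>, then a transversal \<open>T\<close> of these components
  containing a given vertex can be chosen in \<open>n ^ (c - 1)\<close> ways, \<open>X\<close> lies in a ball around \<open>T\<close>, and
  at most \<open>Suc (r - c) choose 2\<close> pairs of \<open>X\<close> lie in \<open>shadow H\<close>.\<close>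

lemma sum_overlapping_le:
  fixes p :: real and r n D :: nat
  assumes H: "H \<subseteq> possible_hyperedges r n" "j \<in> H"
    and deg: "\<And>v. card {g \<in> H. v \<in> g} \<le> D"
    and clique: "\<And>X. X \<in> possible_hyperedges r n \<Longrightarrow> pairs X \<subseteq> shadow H \<Longrightarrow> X \<in> H"
    and p: "0 \<le> p" "p \<le> 1"
  shows "(\<Sum>X | X \<in> possible_hyperedges r n \<and> X \<notin> H \<and> pairs X \<inter> pairs j \<noteq> {}.
      p ^ card (pairs X - shadow H)) \<le>
    (\<Sum>c\<in>{1..<r}. real r * real n ^ (c - 1) * real (r * (1 + D * r) ^ (r * r)) ^ r *
      p ^ max 1 ((r choose 2) - (Suc (r - c) choose 2)))"
proof -
  \<comment> \<open>For \<open>c = 1\<close> the difference is 0, and a factor \<open>p\<close>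
    comes only from the fact that some pair of \<open>X\<close> lies outside the shadow; hence the
    maximum with 1.\<close>
  define M where "M c = max 1 ((r choose 2) - (Suc (r - c) choose 2))" for c
  define R where "R = Id \<union> adj H"
  \<comment> \<open>The radius is a crude bound for the walks needed inside \<open>X\<close>, where
    the relation has at most \<open>r * r\<close> pairs.\<close>
  define ball where "ball T = (R ^^ (r * r)) `` T" for T
  define Ts where "Ts v c = {T. {v} \<subseteq> T \<and> T \<subseteq> {1..n} \<and> card T = c}" for v c
  define Xs where "Xs T = {X. {} \<subseteq> X \<and> X \<subseteq> ball T \<and> card X = r}" for T
  define B where "B = r * (1 + D * r) ^ (r * r)"
  define \<X> where "\<X> = {X. X \<in> possible_hyperedges r n \<and> X \<notin> H \<and> pairs X \<inter> pairs j \<noteq> {}}"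
  \<comment> \<open>Each \<open>X\<close> is encoded by a vertex \<open>v\<close> shared with
    \<open>j\<close>, the size \<open>c\<close> of a transversal \<open>T\<close>, the set
    \<open>T\<close> and \<open>X\<close> itself. Several codes for one \<open>X\<close> only
    increase the bound.\<close>
  define I where "I = (SIGMA v:j. SIGMA c:{1..<r}. SIGMA T:Ts v c. Xs T)"
  have edge: "finite g \<and> card g = r \<and> g \<subseteq> {1..n}" if "g \<in> possible_hyperedges r n" for g
    using that by (auto simp: possible_hyperedges_def intro: finite_subset)
  have finH: "finite H"
    using H finite_possible_hyperedges finite_subset by blast
  have ball: "finite (ball T) \<and> card (ball T) \<le> card T * (1 + D * r) ^ (r * r)" if "finite T" for T
    unfolding ball_def R_def using deg finH edge H that
    by (intro card_relpow_Image card_adj_Image) auto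
  have finT: "finite T" if "T \<in> Ts v c" for T v c
    using that by (auto simp: Ts_def intro: finite_subset)
  have finTs: "finite (Ts v c)" for v c
    by (rule finite_subset[of _ "Pow {1..n}"]) (auto simp: Ts_def)
  have finXs: "finite (Xs T)" if "finite T" for T
  proof (rule finite_subset)
    show "Xs T \<subseteq> Pow (ball T)"
      by (auto simp: Xs_def)
    show "finite (Pow (ball T))"
      using ball[OF that] by simp
  qed
  have finj: "finite j" "card j = r"
    using H edge by auto
  have finI: "finite I"
    unfolding I_def using finj finTs finXs finT by (intro finite_SigmaI) auto
  have cover: "\<exists>y\<in>I. snd (snd (snd y)) = X \<and> p ^ card (pairs X - shadow H) \<le> p ^ M (fst (snd y))"
    if X: "X \<in> \<X>" for X
  proof -
    have X': "finite X" "card X = r" "X \<subseteq> {1..n}" "X \<notin> H"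
      using X edge by (auto simp: \<X>_def)
    obtain e where e: "e \<in> pairs X" "e \<in> pairs j"
      using X by (auto simp: \<X>_def)
    then obtain v u where uv: "e = {v, u}" "v \<in> X" "u \<in> X" "v \<noteq> u"
      by (auto elim: pairsE)
    then have uvj: "v \<in> j" "u \<in> j"
      using e(2) by (auto simp: doubleton_in_pairs)
    then have adj: "(v, u) \<in> adj H"
      using H(2) by (auto simp: adj_def)
    obtain T where T: "T \<subseteq> X" "v \<in> T" "X \<subseteq> (adj H \<inter> X \<times> X)\<^sup>* `` T"
      and T_unique: "\<And>u t t'. u \<in> X \<Longrightarrow> t \<in> T \<Longrightarrow> t' \<in> T \<Longrightarrow> u = t \<or> (u, t) \<in> adj H \<Longrightarrow>
        u = t' \<or> (u, t') \<in> adj H \<Longrightarrow> t = t'"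
      using transversal_exists[OF X'(1) uv(2) sym_adj] by metis
    \<comment> \<open>The shared pair joins \<open>v\<close> to another vertex of \<open>X\<close>,
      so not every vertex can represent itself; this is what bounds \<open>c\<close> by
      \<open>r - 1\<close>.\<close>
    have "T \<noteq> X"
      using T_unique[of v v u] uv adj by blast
    then have "card T < r"
      using psubset_card_mono[OF X'(1)] T(1) X'(2) by blast
    moreover have "0 < card T"
      using T(1,2) X'(1) by (metis card_gt_0_iff empty_iff finite_subset)
    ultimately have cT: "card T < r" "0 < card T" .
    have "X \<subseteq> ball T"
    proof
      fix x assume "x \<in> X"
      then obtain t where t: "t \<in> T" "(t, x) \<in> (adj H \<inter> X \<times> X)\<^sup>*"
        using T(3) by auto
      have fin: "finite (adj H \<inter> X \<times> X)"
        using X' by auto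
      have "card (adj H \<inter> X \<times> X) \<le> card (X \<times> X)"
        using X' by (intro card_mono) auto
      then have "card (adj H \<inter> X \<times> X) \<le> r * r"
        using X' by (simp add: card_cartesian_product)
      moreover obtain k where "k \<le> card (adj H \<inter> X \<times> X)" "(t, x) \<in> (adj H \<inter> X \<times> X) ^^ k"
        using t(2) unfolding rtrancl_finite_eq_relpow[OF fin] by auto
      ultimately have "(t, x) \<in> (Id \<union> (adj H \<inter> X \<times> X)) ^^ (r * r)"
        by (meson relpow_Id_extend le_trans)
      moreover have "(Id \<union> (adj H \<inter> X \<times> X)) ^^ (r * r) \<subseteq> R ^^ (r * r)"
        unfolding R_def by (intro relpow_mono) auto
      ultimately show "x \<in> ball T"
        using t(1) by (auto simp: ball_def)
    qed
    then have "(v, card T, T, X) \<in> I"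
      using uvj cT T X' by (auto simp: I_def Ts_def Xs_def)
    moreover have "M (card T) \<le> card (pairs X - shadow H)"
    proof -
      have "card (pairs X) = card (pairs X - shadow H) + card (pairs X \<inter> shadow H)"
        using X' by (metis add.commute card_Diff_subset_Int card_mono finite_Int finite_pairs
            inf_le1 le_add_diff_inverse)
      moreover have "card (pairs X \<inter> shadow H) \<le> Suc (card X - card T) choose 2"
        by (rule card_shadow_pairs_le[OF X'(1) T(1)]) (rule T_unique)
      moreover have "pairs X - shadow H \<noteq> {}"
        using clique[of X] X X' by (auto simp: \<X>_def)
      then have "card (pairs X - shadow H) \<ge> 1"
        using X' by (simp add: Suc_leI card_gt_0_iff finite_pairs)
      ultimately show ?thesis
        using X' by (simp add: M_def card_pairs)
    qed
    then have "p ^ card (pairs X - shadow H) \<le> p ^ M (card T)"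
      using p by (intro power_decreasing)
    ultimately show ?thesis
      by force
  qed
  have "(\<Sum>X\<in>\<X>. p ^ card (pairs X - shadow H)) \<le> (\<Sum>y\<in>I. p ^ M (fst (snd y)))"
    using cover p finI finite_possible_hyperedges
    by (intro sum_le_included[where i="\<lambda>y. snd (snd (snd y))"]) (auto simp: \<X>_def)
  also have "\<dots> = (\<Sum>v\<in>j. \<Sum>c\<in>{1..<r}. \<Sum>T\<in>Ts v c. \<Sum>X\<in>Xs T. p ^ M c)"
    unfolding I_def using finj finTs finXs finT
    by (simp add: sum_Sigma_Pair sum_distrib_right cong: sum.cong)
  also have "\<dots> \<le> (\<Sum>v\<in>j. \<Sum>c\<in>{1..<r}. real n ^ (c - 1) * real B ^ r * p ^ M c)"
  proof (intro sum_mono)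
    fix v c assume vc: "v \<in> j" "c \<in> {1..<r}"
    have "(\<Sum>X\<in>Xs T. p ^ M c) \<le> real B ^ r * p ^ M c" if T: "T \<in> Ts v c" for T
    proof -
      have "card T \<le> r"
        using T vc by (auto simp: Ts_def)
      then have "card (ball T) \<le> B"
        using ball[OF finT[OF T]] unfolding B_def by (meson le_trans mult_le_mono1)
      then have "card (ball T) ^ r \<le> B ^ r"
        by (rule power_mono) auto
      moreover have "card (Xs T) \<le> card (ball T) ^ r"
        unfolding Xs_def using card_supersets_le[of "ball T" "{}" r] ball[OF finT[OF T]] by simp
      ultimately have "real (card (Xs T)) \<le> real B ^ r"
        by (metis le_trans of_nat_le_iff of_nat_power)
      then show ?thesis
        using p by (simp add: mult_right_mono)
    qed
    then have "(\<Sum>T\<in>Ts v c. \<Sum>X\<in>Xs T. p ^ M c) \<le> (\<Sum>T\<in>Ts v c. real B ^ r * p ^ M c)"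
      by (intro sum_mono)
    also have "\<dots> = real (card (Ts v c)) * (real B ^ r * p ^ M c)"
      by simp
    also have "card (Ts v c) \<le> n ^ (c - 1)"
      unfolding Ts_def using card_supersets_le[of "{1..n}" "{v}" c] vc by simp
    then have "real (card (Ts v c)) * (real B ^ r * p ^ M c) \<le> real n ^ (c - 1) * (real B ^ r * p ^ M c)"
      using p by (intro mult_right_mono) (auto simp flip: of_nat_power)
    finally show "(\<Sum>T\<in>Ts v c. \<Sum>X\<in>Xs T. p ^ M c) \<le> real n ^ (c - 1) * real B ^ r * p ^ M c"
      by (simp add: mult.assoc)
  qed
  also have "\<dots> = (\<Sum>c\<in>{1..<r}. real r * real n ^ (c - 1) * real B ^ r * p ^ M c)"
    using finj(2) by (simp add: sum_distrib_left mult.assoc)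
  finally show ?thesis
    unfolding \<X>_def M_def B_def .
qed

subsection \<open>Typical properties of the random hypergraph\<close>

lemma sum_prod_Pow_le_exp:
  fixes w :: "'a \<Rightarrow> real"
  assumes "finite W" "\<And>g. g \<in> W \<Longrightarrow> 0 \<le> w g"
  shows "(\<Sum>K\<in>Pow W. \<Prod>g\<in>K. w g) \<le> exp (\<Sum>g\<in>W. w g)"
proof -
  have "(\<Sum>K\<in>Pow W. \<Prod>g\<in>K. w g) = (\<Prod>g\<in>W. w g + 1)"
    using assms(1) by (simp add: prod_add)
  also have "\<dots> \<le> (\<Prod>g\<in>W. exp (w g))"
    using assms(2) by (intro prod_mono) (auto simp: add.commute)
  also have "\<dots> = exp (\<Sum>g\<in>W. w g)"
    using assms(1) by (simp add: exp_sum)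
  finally show ?thesis .
qed

text \<open>Dividing the weights by \<open>s\<close> makes their total at most 1, and for at most
  \<open>m\<close> factors this costs at most \<open>s ^ m\<close>. The result is polynomial in
  \<open>s\<close>, where the bound for all subsets would give \<open>exp s\<close>.\<close>

lemma sum_prod_small_subsets_le:
  fixes w :: "'a \<Rightarrow> real"
  assumes "finite W" "\<And>g. g \<in> W \<Longrightarrow> 0 \<le> w g" "(\<Sum>g\<in>W. w g) \<le> s" "1 \<le> s"
  shows "(\<Sum>K | K \<subseteq> W \<and> card K \<le> m. \<Prod>g\<in>K. w g) \<le> exp 1 * s ^ m"
proof -
  have "(\<Prod>g\<in>K. w g) \<le> s ^ m * (\<Prod>g\<in>K. w g / s)" if "K \<subseteq> W" "card K \<le> m" for K
  proof -
    have "(\<Prod>g\<in>K. w g) = s ^ card K * (\<Prod>g\<in>K. w g / s)"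
      using assms(4) by (simp add: prod_dividef)
    also have "\<dots> \<le> s ^ m * (\<Prod>g\<in>K. w g / s)"
      using that assms by (intro mult_right_mono power_increasing prod_nonneg) auto
    finally show ?thesis .
  qed
  then have "(\<Sum>K | K \<subseteq> W \<and> card K \<le> m. \<Prod>g\<in>K. w g) \<le>
    (\<Sum>K | K \<subseteq> W \<and> card K \<le> m. s ^ m * (\<Prod>g\<in>K. w g / s))"
    by (intro sum_mono) auto
  also have "\<dots> \<le> (\<Sum>K\<in>Pow W. s ^ m * (\<Prod>g\<in>K. w g / s))"
    using assms by (intro sum_mono2) (auto intro!: mult_nonneg_nonneg prod_nonneg)
  also have "\<dots> = s ^ m * (\<Sum>K\<in>Pow W. \<Prod>g\<in>K. w g / s)"
    by (simp add: sum_distrib_left)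
  also have "\<dots> \<le> s ^ m * exp (\<Sum>g\<in>W. w g / s)"
    using assms by (intro mult_left_mono sum_prod_Pow_le_exp) auto
  also have "(\<Sum>g\<in>W. w g / s) \<le> 1"
    using assms(3,4) by (simp flip: sum_divide_distrib)
  then have "s ^ m * exp (\<Sum>g\<in>W. w g / s) \<le> s ^ m * exp 1"
    using assms(4) by (intro mult_left_mono) auto
  finally show ?thesis
    by (simp add: mult.commute)
qed

text \<open>This fails for \<open>card X = 3\<close>: three pairs cover a triangle and have total weight \<open>3\<close>.\<close>

lemma pair_cover_weight:
  assumes X: "finite X" "card X \<ge> 4" and K: "finite K"
    and meet: "\<And>g. g \<in> K \<Longrightarrow> 2 \<le> card (g \<inter> X)" and proper: "\<And>g. g \<in> K \<Longrightarrow> \<not> X \<subseteq> g"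
    and cover: "pairs X \<subseteq> shadow K"
  shows "card X + 1 \<le> (\<Sum>g\<in>K. card (g \<inter> X) - 1)"
proof (cases "\<exists>g0\<in>K. 3 \<le> card (g0 \<inter> X)")
  case True
  then obtain g0 where g0: "g0 \<in> K" "3 \<le> card (g0 \<inter> X)"
    by blast
  obtain x where x: "x \<in> X" "x \<notin> g0"
    using proper[OF g0(1)] by blast
  \<comment> \<open>The members through \<open>x\<close> cover the other \<open>card X - 1\<close>
    vertices of \<open>X\<close>, and \<open>g0\<close>, which avoids \<open>x\<close>, contributes
    at least 2 more.\<close>
  define K' where "K' = {g \<in> K. x \<in> g}"
  have "X - {x} \<subseteq> (\<Union>g\<in>K'. g \<inter> X - {x})"
  proof
    fix y assume y: "y \<in> X - {x}"
    then have "{x, y} \<in> shadow K"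
      using cover x by (auto simp: doubleton_in_pairs)
    then show "y \<in> (\<Union>g\<in>K'. g \<inter> X - {x})"
      using y by (auto simp: shadow_def doubleton_in_pairs K'_def)
  qed
  then have "card (X - {x}) \<le> card (\<Union>g\<in>K'. g \<inter> X - {x})"
    using X K by (intro card_mono) (auto simp: K'_def)
  also have "\<dots> \<le> (\<Sum>g\<in>K'. card (g \<inter> X - {x}))"
    using K by (intro card_UN_le) (auto simp: K'_def)
  also have "\<dots> = (\<Sum>g\<in>K'. card (g \<inter> X) - 1)"
    using x X by (intro sum.cong) (auto simp: K'_def)
  finally have "card X - 1 \<le> (\<Sum>g\<in>K'. card (g \<inter> X) - 1)"
    using x X by simp
  moreover have "(\<Sum>g\<in>insert g0 K'. card (g \<inter> X) - 1) \<le> (\<Sum>g\<in>K. card (g \<inter> X) - 1)"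
    using K g0 by (intro sum_mono2) (auto simp: K'_def)
  moreover have "(\<Sum>g\<in>insert g0 K'. card (g \<inter> X) - 1) = (card (g0 \<inter> X) - 1) + (\<Sum>g\<in>K'. card (g \<inter> X) - 1)"
    using K x by (intro sum.insert) (auto simp: K'_def)
  ultimately show ?thesis
    using g0(2) X(2) by linarith
next
  case False
  \<comment> \<open>Now every trace on \<open>X\<close> is a single pair, so the weight is at least
    the number of pairs, and \<open>card X choose 2\<close> exceeds \<open>card X\<close> when
    \<open>card X \<ge> 4\<close>.\<close>
  then have two: "card (g \<inter> X) = 2" if "g \<in> K" for g
  proof -
    have "\<not> 3 \<le> card (g \<inter> X)"
      using False that by blast
    then show ?thesis
      using meet[OF that] by linarith
  qed
  have "pairs X \<subseteq> (\<Union>g\<in>K. pairs (g \<inter> X))"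
  proof
    fix e assume e: "e \<in> pairs X"
    then obtain g where "g \<in> K" "e \<in> pairs g"
      using cover by (auto simp: shadow_def)
    then show "e \<in> (\<Union>g\<in>K. pairs (g \<inter> X))"
      using e by (auto simp: pairs_def)
  qed
  then have "card (pairs X) \<le> card (\<Union>g\<in>K. pairs (g \<inter> X))"
    using X K by (intro card_mono) (auto simp: finite_pairs)
  also have "\<dots> \<le> (\<Sum>g\<in>K. card (pairs (g \<inter> X)))"
    using K by (rule card_UN_le)
  also have "\<dots> = (\<Sum>g\<in>K. card (g \<inter> X) - 1)"
    using X two by (intro sum.cong) (auto simp: card_pairs)
  finally have "card X choose 2 \<le> (\<Sum>g\<in>K. card (g \<inter> X) - 1)"
    using X by (simp add: card_pairs)
  moreover have "card X + 1 \<le> card X choose 2"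
  proof -
    have "4 * (card X - 1) \<le> card X * (card X - 1)"
      using X(2) by (intro mult_right_mono) auto
    then show ?thesis
      using X(2) unfolding choose_two by linarith
  qed
  ultimately show ?thesis
    by linarith
qed

text \<open>If hyperedges other than \<open>X\<close> cover the pairs of \<open>X\<close>, at most
  \<open>r choose 2\<close> of them suffice. In the weighted sum over such covers \<open>K\<close>,
  \<open>pair_cover_weight\<close> gains a factor \<open>real n ^ (r + 1)\<close>, one power more
  than the choice of \<open>X\<close> costs.\<close>

lemma prob_uncovered_clique_le:
  fixes q x :: real and r n :: nat
  assumes r: "r \<ge> 4" and n: "n \<ge> 1" and q: "0 \<le> q" "q \<le> 1"
    and x: "real n ^ (r - 1) * q \<le> x" "1 \<le> x"
  shows "measure_pmf.prob (random_hypergraph r n q)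
      {H. \<exists>X\<in>possible_hyperedges r n. X \<notin> H \<and> pairs X \<subseteq> shadow H}
    \<le> exp 1 * (2 ^ r * x) ^ (r choose 2) / real n"
proof -
  let ?V = "possible_hyperedges r n"
  let ?M = "measure_pmf.prob (random_subset ?V q)"
  define m where "m = r choose 2"
  define s where "s = 2 ^ r * x"
  define W where "W X = {g \<in> ?V. g \<noteq> X \<and> 2 \<le> card (g \<inter> X)}" for X
  define \<K> where "\<K> X = {K. K \<subseteq> W X \<and> card K \<le> m \<and> pairs X \<subseteq> shadow K}" for X
  \<comment> \<open>At most \<open>real n ^ (r - card B)\<close> hyperedges contain a given
    \<open>B\<close>, so with this weight every trace \<open>B\<close> on \<open>X\<close>
    contributes at most \<open>real n ^ (r - 1) * q\<close>, whatever its size.\<close>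
  define w where "w X g = q * real n ^ (card (g \<inter> X) - 1)" for X g :: "nat set"
  have edge: "finite g \<and> card g = r \<and> g \<subseteq> {1..n}" if "g \<in> ?V" for g
    using that by (auto simp: possible_hyperedges_def intro: finite_subset)
  have finW: "finite (W X)" for X
    using finite_possible_hyperedges by (auto simp: W_def)
  have fin\<K>: "finite (\<K> X)" for X
    by (rule finite_subset[of _ "Pow (W X)"]) (auto simp: \<K>_def finW)
  have "1 \<le> (2::real) ^ r * x"
    using x(2) mult_mono[of 1 "2 ^ r" 1 x] by simp
  then have s: "1 \<le> s"
    by (simp add: s_def)
  have weight: "(\<Sum>g\<in>W X. w X g) \<le> s" if X: "X \<in> ?V" for X
  proof -
    define Bs where "Bs = {B. B \<subseteq> X \<and> B \<noteq> {}}"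
    define Gs where "Gs B = {g. B \<subseteq> g \<and> g \<subseteq> {1..n} \<and> card g = r}" for B
    have finBs: "finite Bs"
      using edge[OF X] by (auto simp: Bs_def)
    have finGs: "finite (Gs B)" for B
      by (rule finite_subset[of _ "Pow {1..n}"]) (auto simp: Gs_def)
    have "(\<Sum>g\<in>W X. w X g) \<le> (\<Sum>y\<in>Sigma Bs Gs. q * real n ^ (card (fst y) - 1))"
    proof (rule sum_le_included[where i=snd])
      show "\<forall>g\<in>W X. \<exists>y\<in>Sigma Bs Gs. snd y = g \<and> w X g \<le> q * real n ^ (card (fst y) - 1)"
      proof
        fix g assume g: "g \<in> W X"
        then have "g \<inter> X \<noteq> {}"
          by (auto simp: W_def)
        then have "(g \<inter> X, g) \<in> Sigma Bs Gs"
          using edge[of g] g by (auto simp: Bs_def Gs_def W_def)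
        then show "\<exists>y\<in>Sigma Bs Gs. snd y = g \<and> w X g \<le> q * real n ^ (card (fst y) - 1)"
          by (intro bexI) (auto simp: w_def)
      qed
    qed (use finBs finGs finW q in auto)
    also have "\<dots> = (\<Sum>B\<in>Bs. \<Sum>g\<in>Gs B. q * real n ^ (card B - 1))"
      using finBs finGs by (simp add: sum_Sigma_Pair)
    also have "\<dots> \<le> (\<Sum>B\<in>Bs. x)"
    proof (rule sum_mono)
      fix B assume B: "B \<in> Bs"
      have cB: "finite B" "card B \<le> r" "1 \<le> card B"
        using B edge[OF X] by (auto simp: Bs_def Suc_le_eq card_gt_0_iff intro: finite_subset card_mono)
      have "real (card (Gs B)) \<le> real n ^ (r - card B)"
        unfolding Gs_def using card_supersets_le[of "{1..n}" B r] cB by (simp flip: of_nat_power)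
      then have "(\<Sum>g\<in>Gs B. q * real n ^ (card B - 1)) \<le> real n ^ (r - card B) * (q * real n ^ (card B - 1))"
        using q by (simp add: mult_right_mono)
      also have "\<dots> = real n ^ (r - 1) * q"
        using cB by (simp flip: power_add)
      also have "\<dots> \<le> x"
        by (rule x)
      finally show "(\<Sum>g\<in>Gs B. q * real n ^ (card B - 1)) \<le> x" .
    qed
    also have "\<dots> = real (card Bs) * x"
      by simp
    also have "card Bs \<le> card (Pow X)"
      using edge[OF X] by (intro card_mono) (auto simp: Bs_def)
    then have "real (card Bs) \<le> 2 ^ r"
      using edge[OF X] by (simp add: card_Pow)
    then have "real (card Bs) * x \<le> 2 ^ r * x"
      using x(2) by (intro mult_right_mono) auto
    finally show ?thesis
      by (simp add: s_def)
  qed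
  have weighted: "q ^ card K \<le> (\<Prod>g\<in>K. w X g) / real n ^ (r + 1)" if X: "X \<in> ?V" and K: "K \<in> \<K> X" for X K
  proof -
    have KW: "K \<subseteq> W X"
      using K by (simp add: \<K>_def)
    have proper: "\<not> X \<subseteq> g" if "g \<in> K" for g
    proof -
      have "g \<in> ?V" "g \<noteq> X"
        using that KW by (auto simp: W_def)
      then show ?thesis
        using edge[of g] edge[OF X] card_subset_eq[of g X] by metis
    qed
    have "r + 1 \<le> (\<Sum>g\<in>K. card (g \<inter> X) - 1)"
      using pair_cover_weight[of X K] edge[OF X] r finite_subset[OF KW finW] proper KW K
      by (auto simp: \<K>_def W_def)
    then have "real n ^ (r + 1) \<le> real n ^ (\<Sum>g\<in>K. card (g \<inter> X) - 1)"
      using n by (intro power_increasing) auto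
    then have "q ^ card K * real n ^ (r + 1) \<le> q ^ card K * real n ^ (\<Sum>g\<in>K. card (g \<inter> X) - 1)"
      using q by (intro mult_left_mono) auto
    also have "\<dots> = (\<Prod>g\<in>K. w X g)"
      by (simp add: w_def prod.distrib power_sum)
    finally show ?thesis
      using n by (simp add: field_simps)
  qed
  have "{H. \<exists>X\<in>?V. X \<notin> H \<and> pairs X \<subseteq> shadow H} \<inter> set_pmf (random_subset ?V q)
    \<subseteq> (\<Union>X\<in>?V. \<Union>K\<in>\<K> X. {H. K \<subseteq> H})"
  proof
    fix H assume H: "H \<in> {H. \<exists>X\<in>?V. X \<notin> H \<and> pairs X \<subseteq> shadow H} \<inter> set_pmf (random_subset ?V q)"
    then have HV: "H \<subseteq> ?V"
      using set_pmf_random_subset by blast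
    obtain X where X: "X \<in> ?V" "X \<notin> H" "pairs X \<subseteq> shadow H"
      using H by blast
    have "\<forall>e\<in>pairs X. \<exists>g\<in>H. e \<in> pairs g"
      using X(3) by (auto simp: shadow_def)
    \<comment> \<open>Choosing one hyperedge per pair yields a cover whose size is bounded
      independently of \<open>H\<close>.\<close>
    then obtain f where f: "\<And>e. e \<in> pairs X \<Longrightarrow> f e \<in> H \<and> e \<in> pairs (f e)"
      by metis
    have "f e \<in> W X" if e: "e \<in> pairs X" for e
    proof -
      have "e \<subseteq> f e \<inter> X" "card e = 2"
        using f[OF e] e by (auto simp: pairs_def)
      then have "2 \<le> card (f e \<inter> X)"
        using edge[OF X(1)] by (metis card_mono finite_Int)
      then show ?thesis
        using f[OF e] X HV by (auto simp: W_def)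
    qed
    moreover have "card (f ` pairs X) \<le> m"
      using edge[OF X(1)] card_image_le[of "pairs X" f] by (simp add: card_pairs finite_pairs m_def)
    moreover have "pairs X \<subseteq> shadow (f ` pairs X)"
      using f by (auto simp: shadow_def)
    ultimately have "f ` pairs X \<in> \<K> X"
      by (auto simp: \<K>_def)
    moreover have "f ` pairs X \<subseteq> H"
      using f by auto
    ultimately show "H \<in> (\<Union>X\<in>?V. \<Union>K\<in>\<K> X. {H. K \<subseteq> H})"
      using X(1) by blast
  qed
  then have "?M {H. \<exists>X\<in>?V. X \<notin> H \<and> pairs X \<subseteq> shadow H} \<le> ?M (\<Union>X\<in>?V. \<Union>K\<in>\<K> X. {H. K \<subseteq> H})"
    by (subst measure_Int_set_pmf[symmetric]) (rule measure_pmf.finite_measure_mono, auto)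
  also have "\<dots> \<le> (\<Sum>X\<in>?V. ?M (\<Union>K\<in>\<K> X. {H. K \<subseteq> H}))"
    by (intro measure_pmf.finite_measure_subadditive_finite finite_possible_hyperedges) auto
  also have "\<dots> \<le> (\<Sum>X\<in>?V. \<Sum>K\<in>\<K> X. ?M {H. K \<subseteq> H})"
    by (intro sum_mono measure_pmf.finite_measure_subadditive_finite fin\<K>) auto
  also have "\<dots> = (\<Sum>X\<in>?V. \<Sum>K\<in>\<K> X. q ^ card K)"
    using q by (intro sum.cong refl prob_random_subset_superset finite_possible_hyperedges)
      (auto simp: \<K>_def W_def)
  also have "\<dots> \<le> (\<Sum>X\<in>?V. exp 1 * s ^ m / real n ^ (r + 1))"
  proof (rule sum_mono)
    fix X assume X: "X \<in> ?V"
    have wpos: "0 \<le> w X g" for g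
      using q by (simp add: w_def)
    have "(\<Sum>K\<in>\<K> X. q ^ card K) \<le> (\<Sum>K\<in>\<K> X. (\<Prod>g\<in>K. w X g) / real n ^ (r + 1))"
      by (intro sum_mono weighted X)
    also have "\<dots> = (\<Sum>K\<in>\<K> X. \<Prod>g\<in>K. w X g) / real n ^ (r + 1)"
      by (simp add: sum_divide_distrib)
    also have "(\<Sum>K\<in>\<K> X. \<Prod>g\<in>K. w X g) \<le> (\<Sum>K | K \<subseteq> W X \<and> card K \<le> m. \<Prod>g\<in>K. w X g)"
      using wpos finW[of X] by (intro sum_mono2) (auto simp: \<K>_def prod_nonneg)
    also have "\<dots> \<le> exp 1 * s ^ m"
      using wpos finW weight[OF X] s by (intro sum_prod_small_subsets_le) auto
    finally show "(\<Sum>K\<in>\<K> X. q ^ card K) \<le> exp 1 * s ^ m / real n ^ (r + 1)"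
      by (simp add: divide_right_mono)
  qed
  also have "\<dots> = real (card ?V) * (exp 1 * s ^ m / real n ^ (r + 1))"
    by simp
  also have "real (card ?V) \<le> real n ^ r"
    using card_supersets_le[of "{1..n}" "{}" r] by (simp add: possible_hyperedges_def flip: of_nat_power)
  then have "real (card ?V) * (exp 1 * s ^ m / real n ^ (r + 1)) \<le> real n ^ r * (exp 1 * s ^ m / real n ^ (r + 1))"
    using s by (intro mult_right_mono) auto
  also have "\<dots> = exp 1 * s ^ m / real n"
    using n by (simp add: field_simps)
  finally show ?thesis
    by (simp add: random_hypergraph_eq_random_subset s_def m_def)
qed

text \<open>A union bound over \<open>k\<close> hyperedges through a common vertex. Writing
  \<open>q ^ k\<close> as \<open>(2 * q) ^ k / 2 ^ k\<close> and then summing over sets of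
  hyperedges of any size bounds the contribution of each vertex by
  \<open>exp (2 * x) / 2 ^ k\<close>.\<close>

lemma prob_large_degree_le:
  fixes q x :: real and r n k :: nat
  assumes r: "r \<ge> 1" and k: "k \<ge> 1" and q: "0 \<le> q" "q \<le> 1" and x: "real n ^ (r - 1) * q \<le> x"
  shows "measure_pmf.prob (random_hypergraph r n q) {H. \<exists>v. k \<le> card {g \<in> H. v \<in> g}}
    \<le> real n * exp (2 * x) / 2 ^ k"
proof -
  let ?V = "possible_hyperedges r n"
  let ?M = "measure_pmf.prob (random_subset ?V q)"
  define S where "S v = {g. {v} \<subseteq> g \<and> g \<subseteq> {1..n} \<and> card g = r}" for v :: nat
  define \<K> where "\<K> v = {K. K \<subseteq> S v \<and> card K = k}" for v
  have finS: "finite (S v)" for v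
    by (rule finite_subset[of _ "Pow {1..n}"]) (auto simp: S_def)
  have fin\<K>: "finite (\<K> v)" for v
    by (rule finite_subset[of _ "Pow (S v)"]) (auto simp: \<K>_def finS)
  have "{H. \<exists>v. k \<le> card {g \<in> H. v \<in> g}} \<inter> set_pmf (random_subset ?V q)
    \<subseteq> (\<Union>v\<in>{1..n}. \<Union>K\<in>\<K> v. {H. K \<subseteq> H})"
  proof
    fix H assume H: "H \<in> {H. \<exists>v. k \<le> card {g \<in> H. v \<in> g}} \<inter> set_pmf (random_subset ?V q)"
    then have HV: "H \<subseteq> ?V"
      using set_pmf_random_subset by blast
    obtain v where v: "k \<le> card {g \<in> H. v \<in> g}"
      using H by blast
    obtain K where K: "K \<subseteq> {g \<in> H. v \<in> g}" "card K = k"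
      using obtain_subset_with_card_n[OF v] by blast
    then have "K \<in> \<K> v"
      using HV by (auto simp: \<K>_def S_def possible_hyperedges_def)
    \<comment> \<open>The event ranges over all naturals \<open>v\<close>; as
      \<open>k \<ge> 1\<close>, such a \<open>v\<close> lies in some hyperedge and hence in
      \<open>{1..n}\<close>.\<close>
    moreover have "v \<in> {1..n}"
    proof -
      obtain g where "g \<in> K"
        using K(2) k by fastforce
      then have "v \<in> g" "g \<subseteq> {1..n}"
        using K(1) HV by (auto simp: possible_hyperedges_def)
      then show ?thesis
        by blast
    qed
    ultimately show "H \<in> (\<Union>v\<in>{1..n}. \<Union>K\<in>\<K> v. {H. K \<subseteq> H})"
      using K(1) by blast
  qed
  then have "?M {H. \<exists>v. k \<le> card {g \<in> H. v \<in> g}} \<le> ?M (\<Union>v\<in>{1..n}. \<Union>K\<in>\<K> v. {H. K \<subseteq> H})"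
    by (subst measure_Int_set_pmf[symmetric]) (rule measure_pmf.finite_measure_mono, auto)
  also have "\<dots> \<le> (\<Sum>v\<in>{1..n}. ?M (\<Union>K\<in>\<K> v. {H. K \<subseteq> H}))"
    by (intro measure_pmf.finite_measure_subadditive_finite) auto
  also have "\<dots> \<le> (\<Sum>v\<in>{1..n}. \<Sum>K\<in>\<K> v. ?M {H. K \<subseteq> H})"
    by (intro sum_mono measure_pmf.finite_measure_subadditive_finite fin\<K>) auto
  also have "\<dots> = (\<Sum>v\<in>{1..n}. \<Sum>K\<in>\<K> v. q ^ k)"
  proof (intro sum.cong refl)
    fix v K assume "v \<in> {1..n}" and K: "K \<in> \<K> v"
    then show "?M {H. K \<subseteq> H} = q ^ k"
      using q prob_random_subset_superset[OF finite_possible_hyperedges, of K r n q]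
      by (auto simp: \<K>_def S_def possible_hyperedges_def)
  qed
  also have "\<dots> \<le> (\<Sum>v\<in>{1..n}. exp (2 * x) / 2 ^ k)"
  proof (rule sum_mono)
    fix v
    have "(\<Sum>K\<in>\<K> v. q ^ k) = (\<Sum>K\<in>\<K> v. \<Prod>g\<in>K. 2 * q) / 2 ^ k"
      by (auto simp: \<K>_def sum_divide_distrib power_mult_distrib intro!: sum.cong)
    also have "(\<Sum>K\<in>\<K> v. \<Prod>g\<in>K. 2 * q) \<le> (\<Sum>K\<in>Pow (S v). \<Prod>g\<in>K. 2 * q)"
      using q finS by (intro sum_mono2) (auto simp: \<K>_def)
    also have "\<dots> \<le> exp (\<Sum>g\<in>S v. 2 * q)"
      using q finS by (intro sum_prod_Pow_le_exp) auto
    also have "(\<Sum>g\<in>S v. 2 * q) = 2 * (real (card (S v)) * q)"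
      by simp
    also have "real (card (S v)) \<le> real n ^ (r - 1)"
      unfolding S_def using card_supersets_le[of "{1..n}" "{v}" r] r by (simp flip: of_nat_power)
    then have "2 * (real (card (S v)) * q) \<le> 2 * x"
      using mult_right_mono[of "real (card (S v))" "real n ^ (r - 1)" q] q x by simp
    finally show "(\<Sum>K\<in>\<K> v. q ^ k) \<le> exp (2 * x) / 2 ^ k"
      by (simp add: divide_right_mono)
  qed
  finally show ?thesis
    by (simp add: random_hypergraph_eq_random_subset)
qed

subsection \<open>Coupling graphs and hypergraphs\<close>

lemma cond_pmf_UNIV: "cond_pmf \<mu> UNIV = \<mu>"
  by (rule pmf_eqI) (simp add: pmf_cond set_pmf_not_empty)

text \<open>Both exceptional events concern \<open>H\<close> alone, so their probabilities can be
  read off the marginal. Outside them the sum \<open>Q\<close> is at most \<open>\<delta>\<close>,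
  so the conditional probability for a member of \<open>H\<close> never drops below \<open>q\<close>
  and the failure clause of the sequential coupling is impossible.\<close>

lemma clique_coupling_exists:
  fixes p q \<delta> :: real and r n D :: nat
  assumes p: "0 \<le> p" "p \<le> 1" and q: "0 \<le> q" "q \<le> p ^ (r choose 2) * (1 - \<delta>)"
    and \<delta>: "0 \<le> \<delta>" "\<delta> \<le> 1"
    and sum_le: "(\<Sum>c\<in>{1..<r}. real r * real n ^ (c - 1) * real (r * (1 + D * r) ^ (r * r)) ^ r *
      p ^ max 1 ((r choose 2) - (Suc (r - c) choose 2))) \<le> \<delta>"
  obtains J where "is_coupling J (random_graph n p) (random_hypergraph r n q)"
    "1 \<le> measure_pmf.prob J {(G, H). \<forall>h\<in>H. has_complete_graph_on G r h} +
      (measure_pmf.prob (random_hypergraph r n q) {H. \<exists>v. Suc D \<le> card {g \<in> H. v \<in> g}} +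
       measure_pmf.prob (random_hypergraph r n q)
         {H. \<exists>X\<in>possible_hyperedges r n. X \<notin> H \<and> pairs X \<subseteq> shadow H})"
proof -
  let ?V = "possible_hyperedges r n"
  define \<mu> where "\<mu> = random_subset (possible_hyperedges 2 n) p"
  define A where "A h = {G. pairs h \<subseteq> G}" for h :: "nat set"
  define B1 where "B1 = {H :: nat set set. \<exists>v. Suc D \<le> card {g \<in> H. v \<in> g}}"
  define B2 where "B2 = {H. \<exists>X\<in>?V. X \<notin> H \<and> pairs X \<subseteq> shadow H}"
  have "p ^ (r choose 2) * (1 - \<delta>) \<le> 1"
    using p \<delta> by (intro mult_le_one power_le_one) auto
  then have q1: "q \<le> 1"
    using q(2) by linarith
  have cond: "conditioning A {} {} = UNIV"
    by (auto simp: conditioning_def)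
  obtain J where J: "map_pmf fst J = \<mu>" "map_pmf snd J = random_subset ?V q"
    and J_supp: "\<forall>(G, H) \<in> set_pmf J. (\<forall>h\<in>H. G \<in> A h) \<or>
      (\<exists>j\<in>H. \<exists>Y' N'. Y' \<subseteq> {} \<union> (H - {j}) \<and> N' \<subseteq> {} \<union> (?V - H) \<and>
         set_pmf \<mu> \<inter> conditioning A Y' N' \<noteq> {} \<and>
         measure_pmf.prob (cond_pmf \<mu> (conditioning A Y' N')) (A j) < q)"
    using sequential_coupling[OF finite_possible_hyperedges q(1) q1, of \<mu> A "{}" "{}" r n]
    unfolding cond cond_pmf_UNIV by (auto simp: set_pmf_not_empty)
  have edge: "finite g \<and> card g = r \<and> g \<subseteq> {1..n}" if "g \<in> ?V" for g
    using that by (auto simp: possible_hyperedges_def intro: finite_subset)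
  have pairs_V: "pairs g \<subseteq> possible_hyperedges 2 n" if "g \<in> ?V" for g
    using edge[OF that] by (auto simp: pairs_def possible_hyperedges_def)
  have success: "\<forall>h\<in>H. has_complete_graph_on G r h"
    if GH: "(G, H) \<in> set_pmf J" and good: "H \<notin> B1" "H \<notin> B2" for G H
  proof -
    have HV: "H \<subseteq> ?V"
      using J(2) GH set_pmf_random_subset[of ?V q] by (metis PowD imageI set_map_pmf snd_conv subsetD)
    have "\<not> measure_pmf.prob (cond_pmf \<mu> (conditioning A Y N)) (A j) < q"
      if j: "j \<in> H" and Y: "Y \<subseteq> H - {j}" and N: "N \<subseteq> ?V - H"
        and ne: "set_pmf \<mu> \<inter> conditioning A Y N \<noteq> {}" for j Y N
    proof -
      define R where "R = \<Union> (pairs ` Y)"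
      define Q where "Q = (\<Sum>i | i \<in> N \<and> pairs i \<inter> pairs j - R \<noteq> {}. p ^ card (pairs i - (pairs j \<union> R)))"
      have finN: "finite N"
        using N finite_possible_hyperedges finite_subset by blast
      \<comment> \<open>Replacing \<open>pairs j \<union> R\<close> by the whole shadow makes the
        bound independent of the history; \<open>j\<close> and all of \<open>Y\<close> are
        hyperedges of \<open>H\<close>.\<close>
      have sub: "pairs j \<union> R \<subseteq> shadow H"
        using Y j by (auto simp: R_def shadow_def)
      have "Q \<le> (\<Sum>i | i \<in> N \<and> pairs i \<inter> pairs j - R \<noteq> {}. p ^ card (pairs i - shadow H))"
        unfolding Q_def
      proof (rule sum_mono)
        fix i assume "i \<in> {i. i \<in> N \<and> pairs i \<inter> pairs j - R \<noteq> {}}"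
        then have "i \<in> ?V"
          using N by blast
        then have "finite (pairs i)"
          using edge finite_pairs by blast
        then have "card (pairs i - shadow H) \<le> card (pairs i - (pairs j \<union> R))"
          using sub by (intro card_mono) auto
        then show "p ^ card (pairs i - (pairs j \<union> R)) \<le> p ^ card (pairs i - shadow H)"
          using p by (intro power_decreasing)
      qed
      also have "\<dots> \<le> (\<Sum>X | X \<in> ?V \<and> X \<notin> H \<and> pairs X \<inter> pairs j \<noteq> {}. p ^ card (pairs X - shadow H))"
        using N p finite_possible_hyperedges by (intro sum_mono2) auto
      also have "\<dots> \<le> (\<Sum>c\<in>{1..<r}. real r * real n ^ (c - 1) * real (r * (1 + D * r) ^ (r * r)) ^ r *
        p ^ max 1 ((r choose 2) - (Suc (r - c) choose 2)))"
        using HV j good p by (intro sum_overlapping_le) (auto simp: B1_def B2_def not_le less_Suc_eq_le Suc_le_eq not_less)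
      finally have Q: "Q \<le> \<delta>"
        using sum_le by linarith
      \<comment> \<open>Edges of \<open>j\<close> that are already forced only improve the
        bound.\<close>
      have "card (pairs j - R) \<le> r choose 2"
        using edge[of j] j HV card_mono[of "pairs j" "pairs j - R"] by (auto simp: finite_pairs card_pairs)
      then have "p ^ (r choose 2) \<le> p ^ card (pairs j - R)"
        using p by (intro power_decreasing)
      then have "p ^ (r choose 2) * (1 - \<delta>) \<le> p ^ card (pairs j - R) * (1 - Q)"
        using Q \<delta> p by (intro mult_mono) auto
      also have "\<dots> \<le> measure_pmf.prob (cond_pmf \<mu> (conditioning A Y N)) (A j)"
      proof -
        have A: "A = (\<lambda>i. {G. pairs i \<subseteq> G})"
          by (simp add: A_def fun_eq_iff)
        have pj: "pairs j \<subseteq> possible_hyperedges 2 n"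
          using pairs_V j HV by blast
        have pN: "pairs i \<subseteq> possible_hyperedges 2 n" if "i \<in> N" for i
          using pairs_V N that by blast
        show ?thesis
          unfolding \<mu>_def A Q_def R_def
          by (rule cond_prob_superset_lower_bound[OF finite_possible_hyperedges p finN pj pN
                ne[unfolded \<mu>_def A]])
      qed
      finally show ?thesis
        using q(2) by linarith
    qed
    moreover have "(\<forall>h\<in>H. G \<in> A h) \<or>
      (\<exists>j\<in>H. \<exists>Y N. Y \<subseteq> H - {j} \<and> N \<subseteq> ?V - H \<and> set_pmf \<mu> \<inter> conditioning A Y N \<noteq> {} \<and>
         measure_pmf.prob (cond_pmf \<mu> (conditioning A Y N)) (A j) < q)"
      using bspec[OF J_supp GH] by simp
    ultimately have "\<forall>h\<in>H. G \<in> A h"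
      by meson
    then show ?thesis
      using HV edge by (auto simp: A_def has_complete_graph_on_def doubleton_in_pairs subset_iff)
  qed
  let ?S = "{(G, H). \<forall>h\<in>H. has_complete_graph_on G r h}"
  have "set_pmf J \<subseteq> ?S \<union> (snd -` B1 \<union> snd -` B2)"
    using success by auto
  then have "1 \<le> measure_pmf.prob J (?S \<union> (snd -` B1 \<union> snd -` B2))"
    by (subst measure_pmf.prob_eq_1[THEN iffD2]) (auto simp: AE_measure_pmf_iff)
  also have "\<dots> \<le> measure_pmf.prob J ?S + measure_pmf.prob J (snd -` B1 \<union> snd -` B2)"
    by (rule measure_Un_le) auto
  also have "measure_pmf.prob J (snd -` B1 \<union> snd -` B2) \<le>
    measure_pmf.prob J (snd -` B1) + measure_pmf.prob J (snd -` B2)"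
    by (rule measure_Un_le) auto
  finally have "1 \<le> measure_pmf.prob J ?S +
    (measure_pmf.prob (random_hypergraph r n q) B1 + measure_pmf.prob (random_hypergraph r n q) B2)"
    by (simp add: random_hypergraph_eq_random_subset J(2)[symmetric])
  moreover have "is_coupling J (random_graph n p) (random_hypergraph r n q)"
    using J by (simp add: is_coupling_def random_graph_def random_hypergraph_eq_random_subset \<mu>_def)
  ultimately show ?thesis
    using that unfolding B1_def B2_def by blast
qed

section \<open>Powers of \<open>n\<close> in the error terms\<close>

lemma real_choose_two: "real (n choose 2) = real n * (real n - 1) / 2"
proof (induction n)
  case (Suc n)
  have "Suc n choose 2 = (n choose 2) + n"
    by (simp add: numeral_2_eq_2)
  then show ?case
    using Suc by (simp add: field_simps)
qed simp

text \<open>For \<open>c \<ge> 2\<close> the difference of binomials is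
  \<open>(c - 1) * (2 * r - c) / 2\<close>, so \<open>r\<close> times the left side is at most
  \<open>- (c - 1) * (r - c)\<close>. For \<open>c = 1\<close> the bound comes from the maximum with
  1.\<close>

lemma transversal_exponent_le:
  fixes r c :: nat
  assumes "1 \<le> c" "c < r"
  shows "real (c - 1) - 2 / real r * real (max 1 ((r choose 2) - (Suc (r - c) choose 2))) \<le> - 1 / real r"
proof (cases "c = 1")
  case True
  have "2 / real r * 1 \<le> 2 / real r * real (max 1 ((r choose 2) - (Suc (r - c) choose 2)))"
    by (intro mult_left_mono) auto
  moreover have "1 / real r \<le> 2 / real r"
    by (simp add: divide_right_mono)
  ultimately show ?thesis
    using True by simp
next
  case False
  let ?m = "(r choose 2) - (Suc (r - c) choose 2)"
  have "real (r choose 2) - real (Suc (r - c) choose 2) = (real c - 1) * (2 * real r - real c) / 2"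
    using assms by (simp add: real_choose_two of_nat_diff field_simps)
  then have m: "(real c - 1) * (2 * real r - real c) / 2 \<le> real (max 1 ?m)"
    by linarith
  have "1 * 1 \<le> (real c - 1) * (real r - real c)"
    using False assms by (intro mult_mono) auto
  then have "1 \<le> (real c - 1) * (real r - real c)"
    by simp
  then have "real r * (real c - 1) - (real c - 1) * (2 * real r - real c) \<le> - 1"
    by (simp add: algebra_simps)
  then have "real r * (real c - 1) - 2 * real (max 1 ?m) \<le> - 1"
    using m by linarith
  then have "(real r * (real c - 1) - 2 * real (max 1 ?m)) / real r \<le> - 1 / real r"
    by (rule divide_right_mono) simp
  then show ?thesis
    using assms by (simp add: diff_divide_distrib of_nat_diff)
qed

text \<open>Measured in units of \<open>\<epsilon> * real r ^ 5 = 1 / (4 * real r)\<close>, the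
  exponent without \<open>\<epsilon>\<close> is at most minus four units. The
  \<open>\<epsilon>\<close> in the bound on \<open>p\<close> costs at most one, and the ball sizes
  cost two, since \<open>2 * \<epsilon> * real r ^ 2\<close> is multiplied by
  \<open>r * r * r\<close>; minus one unit remains.\<close>

lemma transversal_sum_le:
  fixes r n :: nat and p \<epsilon> :: real
  assumes r: "r \<ge> 4" and n: "n \<ge> 1" and \<epsilon>: "\<epsilon> = 1 / (4 * real r ^ 6)"
    and p: "0 \<le> p" "p \<le> real n powr (- 2 / real r + \<epsilon>)"
    and D: "real D \<le> real n powr (2 * \<epsilon> * real r ^ 2)"
  shows "(\<Sum>c\<in>{1..<r}. real r * real n ^ (c - 1) * real (r * (1 + D * r) ^ (r * r)) ^ r *
      p ^ max 1 ((r choose 2) - (Suc (r - c) choose 2))) \<le>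
    real r ^ 2 * (real r * (2 * real r) ^ (r * r)) ^ r * real n powr (- 1 / (4 * real r))"
proof -
  define M where "M c = max 1 ((r choose 2) - (Suc (r - c) choose 2))" for c
  define L where "L = (real r * (2 * real r) ^ (r * r)) ^ r"
  define y where "y = real n powr (2 * \<epsilon> * real r ^ 2)"
  have \<epsilon>0: "\<epsilon> > 0"
    using r \<epsilon> by simp
  have y1: "1 \<le> y"
    unfolding y_def using n \<epsilon>0 by (intro ge_one_powr_ge_zero) auto
  have "real (1 + D * r) \<le> 1 + y * real r"
    using D by (simp add: y_def mult_right_mono)
  also have "\<dots> \<le> 2 * real r * y"
    using mult_mono[of 1 y 1 "real r"] y1 r by (simp add: algebra_simps)
  finally have "real (1 + D * r) ^ (r * r) \<le> (2 * real r * y) ^ (r * r)"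
    by (intro power_mono) auto
  then have "real (r * (1 + D * r) ^ (r * r)) \<le> real r * (2 * real r) ^ (r * r) * y ^ (r * r)"
    by (simp add: power_mult_distrib mult_left_mono algebra_simps)
  then have "real (r * (1 + D * r) ^ (r * r)) ^ r \<le> (real r * (2 * real r) ^ (r * r) * y ^ (r * r)) ^ r"
    by (intro power_mono) auto
  also have "\<dots> = L * y ^ (r * r * r)"
    by (simp add: L_def power_mult_distrib flip: power_mult)
  also have "y ^ (r * r * r) = real n powr (2 * \<epsilon> * real r ^ 5)"
    unfolding y_def using n
    by (simp add: powr_powr flip: powr_realpow) (simp add: power_numeral_reduce algebra_simps)
  finally have B: "real (r * (1 + D * r) ^ (r * r)) ^ r \<le> L * real n powr (2 * \<epsilon> * real r ^ 5)" .
  have "real r * real n ^ (c - 1) * real (r * (1 + D * r) ^ (r * r)) ^ r * p ^ M c \<le>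
    real r * L * real n powr (- 1 / (4 * real r))" if c: "c \<in> {1..<r}" for c
  proof -
    have "p ^ M c \<le> (real n powr (- 2 / real r + \<epsilon>)) ^ M c"
      using p by (intro power_mono) auto
    also have "\<dots> = real n powr ((- 2 / real r + \<epsilon>) * real (M c))"
      using n by (simp add: powr_powr flip: powr_realpow)
    finally have "real n ^ (c - 1) * p ^ M c \<le> real n powr real (c - 1) * real n powr ((- 2 / real r + \<epsilon>) * real (M c))"
      using n by (simp add: powr_realpow mult_left_mono)
    then have "(real n ^ (c - 1) * p ^ M c) * real (r * (1 + D * r) ^ (r * r)) ^ r \<le>
      (real n powr real (c - 1) * real n powr ((- 2 / real r + \<epsilon>) * real (M c))) * (L * real n powr (2 * \<epsilon> * real r ^ 5))"
      using B p by (intro mult_mono[OF _ B]) auto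
    also have "\<dots> = L * real n powr (real (c - 1) + (- 2 / real r + \<epsilon>) * real (M c) + 2 * \<epsilon> * real r ^ 5)"
      by (simp add: powr_add)
    also have "\<dots> \<le> L * real n powr (- 1 / (4 * real r))"
    proof (intro mult_left_mono powr_mono)
      have "r choose 2 \<le> r ^ 2"
        using r by (intro binomial_le_pow) auto
      then have "M c \<le> r ^ 2"
        using r by (auto simp: M_def)
      then have "real (M c) \<le> real r ^ 2"
        by (metis of_nat_le_iff of_nat_power)
      also have "\<dots> \<le> real r ^ 5"
        using r by (intro power_increasing) auto
      finally have "\<epsilon> * real (M c) \<le> \<epsilon> * real r ^ 5"
        using \<epsilon>0 by (intro mult_left_mono) auto
      moreover have "\<epsilon> * real r ^ 5 = 1 / (4 * real r)"
        using r by (simp add: \<epsilon> power_numeral_reduce)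
      moreover have "real (c - 1) - 2 / real r * real (M c) \<le> - 1 / real r"
        unfolding M_def using c by (intro transversal_exponent_le) auto
      moreover have "- 1 / real r = - 4 * (1 / (4 * real r))"
        by simp
      moreover have "real (c - 1) + (- 2 / real r + \<epsilon>) * real (M c) + 2 * \<epsilon> * real r ^ 5 =
        (real (c - 1) - 2 / real r * real (M c)) + \<epsilon> * real (M c) + 2 * (\<epsilon> * real r ^ 5)"
        by (simp add: left_diff_distrib)
      ultimately have "real (c - 1) + (- 2 / real r + \<epsilon>) * real (M c) + 2 * \<epsilon> * real r ^ 5 \<le> - (1 / (4 * real r))"
        by linarith
      then show "real (c - 1) + (- 2 / real r + \<epsilon>) * real (M c) + 2 * \<epsilon> * real r ^ 5 \<le> - 1 / (4 * real r)"
        by simp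
    qed (use n in \<open>auto simp: L_def\<close>)
    finally have "(real n ^ (c - 1) * p ^ M c) * real (r * (1 + D * r) ^ (r * r)) ^ r \<le> L * real n powr (- 1 / (4 * real r))" .
    then have "real r * ((real n ^ (c - 1) * p ^ M c) * real (r * (1 + D * r) ^ (r * r)) ^ r) \<le> real r * (L * real n powr (- 1 / (4 * real r)))"
      by (intro mult_left_mono) auto
    then show ?thesis
      by (simp only: mult_ac)
  qed
  then have "(\<Sum>c\<in>{1..<r}. real r * real n ^ (c - 1) * real (r * (1 + D * r) ^ (r * r)) ^ r * p ^ M c) \<le>
    (\<Sum>c\<in>{1..<r}. real r * L * real n powr (- 1 / (4 * real r)))"
    by (intro sum_mono)
  also have "\<dots> = real (r - 1) * (real r * L * real n powr (- 1 / (4 * real r)))"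
    by simp
  also have "\<dots> \<le> real r * (real r * L * real n powr (- 1 / (4 * real r)))"
    by (intro mult_right_mono) (auto simp: L_def)
  finally show ?thesis
    by (simp add: M_def L_def power2_eq_square mult.assoc)
qed

text \<open>\<open>2 / real r\<close> times \<open>r choose 2\<close> equals \<open>r - 1\<close>,
  so only the part of the exponent containing \<open>\<epsilon>\<close> survives.\<close>

lemma expected_degree_le:
  fixes r n :: nat and p \<epsilon> :: real
  assumes "r \<ge> 1" "n \<ge> 1" "0 \<le> \<epsilon>" "0 \<le> p" "p \<le> real n powr (- 2 / real r + \<epsilon>)"
  shows "real n ^ (r - 1) * p ^ (r choose 2) \<le> real n powr (\<epsilon> * real r ^ 2)"
proof -
  have "p ^ (r choose 2) \<le> (real n powr (- 2 / real r + \<epsilon>)) ^ (r choose 2)"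
    using assms by (intro power_mono) auto
  also have "\<dots> = real n powr ((- 2 / real r + \<epsilon>) * real (r choose 2))"
    using assms by (simp add: powr_powr flip: powr_realpow)
  moreover have n: "real n ^ (r - 1) = real n powr real (r - 1)"
    using assms(2) by (intro powr_realpow[symmetric]) simp
  ultimately have "real n ^ (r - 1) * p ^ (r choose 2) \<le>
    real n powr real (r - 1) * real n powr ((- 2 / real r + \<epsilon>) * real (r choose 2))"
    unfolding n by (intro mult_left_mono) auto
  also have "real n powr real (r - 1) * real n powr ((- 2 / real r + \<epsilon>) * real (r choose 2)) =
    real n powr (real (r - 1) + (- 2 / real r + \<epsilon>) * real (r choose 2))"
    by (simp add: powr_add)
  also have "real (r - 1) + (- 2 / real r + \<epsilon>) * real (r choose 2) = \<epsilon> * (real r * (real r - 1) / 2)"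
    using assms by (simp add: real_choose_two of_nat_diff field_simps)
  also have "real n powr \<dots> \<le> real n powr (\<epsilon> * real r ^ 2)"
  proof (intro powr_mono mult_left_mono)
    have "real r * (real r - 1) \<le> real r * (2 * real r)"
      by (intro mult_left_mono) auto
    then show "real r * (real r - 1) / 2 \<le> real r ^ 2"
      by (simp add: power2_eq_square)
  qed (use assms in auto)
  finally show ?thesis .
qed

theorem theorem1:
  fixes r :: nat
  assumes "r \<ge> 4"
  shows "\<exists>\<epsilon>::real. \<epsilon> > 0 \<and>
    (\<forall>p :: nat \<Rightarrow> real.
      (\<forall>n\<ge>1. 0 \<le> p n \<and> p n \<le> real n powr (- 2 / real r + \<epsilon>)) \<longrightarrow>
      (\<exists>q :: nat \<Rightarrow> real.
        (\<forall>n. 0 \<le> q n \<and> q n \<le> 1) \<and>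
        q \<sim>[sequentially] (\<lambda>n. p n ^ (r choose 2)) \<and>
        (\<exists>J :: nat \<Rightarrow> (nat set set \<times> nat set set) pmf.
          (\<forall>n. is_coupling (J n) (random_graph n (p n)) (random_hypergraph r n (q n))) \<and>
          (\<lambda>n. measure_pmf.prob (J n) {(G, H). \<forall>h\<in>H. has_complete_graph_on G r h})
            \<longlonglongrightarrow> 1)))"
proof -
  \<comment> \<open>The sixth power makes \<open>\<epsilon> * real r ^ 5\<close> a quarter of the
    gap \<open>1 / real r\<close> in \<open>transversal_exponent_le\<close>.\<close>
  define \<epsilon> where "\<epsilon> = 1 / (4 * real r ^ 6)"
  define a where "a = \<epsilon> * real r ^ 2"
  define m where "m = r choose 2"
  have \<epsilon>0: "0 < \<epsilon>" and a0: "0 < a"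
    using assms by (simp_all add: \<epsilon>_def a_def)
  have \<epsilon>r: "\<epsilon> \<le> 2 / real r"
  proof -
    have "real r ^ 1 \<le> real r ^ 6"
      using assms by (intro power_increasing) auto
    then have "real r \<le> 4 * real r ^ 6"
      using power_one_right[of "real r"] zero_le_power[of "real r" 6] by linarith
    then have "\<epsilon> \<le> 1 / real r"
      unfolding \<epsilon>_def using assms by (intro divide_left_mono) auto
    also have "\<dots> \<le> 2 / real r"
      by (simp add: divide_right_mono)
    finally show ?thesis .
  qed
  \<comment> \<open>Makes the bound for uncovered cliques, of order
    \<open>real n powr (a * real m) / real n\<close>, tend to 0.\<close>
  have am: "a * real m < 1"
  proof -
    have "m \<le> r ^ 2"
      unfolding m_def using assms by (intro binomial_le_pow) auto
    then have "a * real m \<le> a * real r ^ 2"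
      using a0 by (intro mult_left_mono) (auto simp flip: of_nat_power)
    also have "\<dots> = 1 / (4 * real r ^ 2)"
      using assms by (simp add: a_def \<epsilon>_def power_numeral_reduce)
    also have "\<dots> < 1"
    proof -
      have "1 \<le> real r ^ 2"
        using assms by (intro one_le_power) simp
      then have "1 < 4 * real r ^ 2"
        by linarith
      then show ?thesis
        using divide_less_eq_1_pos[of "4 * real r ^ 2" 1] by linarith
    qed
    finally show ?thesis .
  qed
  show ?thesis
  proof (intro exI[of _ \<epsilon>] conjI allI impI \<epsilon>0)
    fix p :: "nat \<Rightarrow> real"
    assume "\<forall>n\<ge>1. 0 \<le> p n \<and> p n \<le> real n powr (- 2 / real r + \<epsilon>)"
    then have p: "0 \<le> p n" "p n \<le> real n powr (- 2 / real r + \<epsilon>)" if "n \<ge> 1" for n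
      using that by auto
    have p1: "p n \<le> 1" if "n \<ge> 1" for n
    proof -
      have "real n powr (- 2 / real r + \<epsilon>) \<le> real n powr 0"
        using that \<epsilon>r by (intro powr_mono) auto
      then show ?thesis
        using p[OF that] that by simp
    qed
    \<comment> \<open>The exponent is half of the one in \<open>transversal_sum_le\<close>, so
      \<open>\<delta>\<close> eventually absorbs the constant \<open>L\<close> and still tends to
      0.\<close>
    define \<delta> where "\<delta> n = real n powr (- 1 / (8 * real r))" for n :: nat
    \<comment> \<open>The hypothesis says nothing about \<open>p 0\<close>, so \<open>q 0\<close> is
      set separately.\<close>
    define q where "q n = (if n = 0 then 0 else p n ^ m * (1 - \<delta> n))" for n
    \<comment> \<open>Expected degrees are at most \<open>real n powr a\<close>; capping degrees at
      the square of this bound makes an excess superpolynomially unlikely.\<close>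
    define D where "D n = nat \<lfloor>real n powr (2 * a)\<rfloor>" for n :: nat
    define L where "L = real r ^ 2 * (real r * (2 * real r) ^ (r * r)) ^ r"
    define \<eta> where "\<eta> n = real n * exp (2 * real n powr a) * 2 powr (- (real n powr (2 * a))) +
      exp 1 * (2 ^ r) ^ m * (real n powr (a * real m) / real n)" for n :: nat
    have \<delta>: "0 \<le> \<delta> n" "\<delta> n \<le> 1" if "n \<ge> 1" for n
    proof -
      have "real n powr (- 1 / (8 * real r)) \<le> real n powr 0"
        using that by (intro powr_mono) auto
      then show "\<delta> n \<le> 1"
        using that by (simp add: \<delta>_def)
    qed (simp add: \<delta>_def)
    have q_le: "q n \<le> p n ^ m" if "n \<ge> 1" for n
      using that \<delta>[OF that] p(1)[OF that] mult_left_mono[of "1 - \<delta> n" 1 "p n ^ m"] by (simp add: q_def)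
    have q01: "0 \<le> q n \<and> q n \<le> 1" for n
    proof (cases "n = 0")
      case False
      then have n: "n \<ge> 1"
        by simp
      have "p n ^ m \<le> 1"
        using p(1)[OF n] p1[OF n] by (rule power_le_one)
      then show ?thesis
        using q_le[OF n] p(1)[OF n] \<delta>[OF n] False by (auto simp: q_def)
    qed (simp add: q_def)
    have asymp: "q \<sim>[sequentially] (\<lambda>n. p n ^ (r choose 2))"
    proof -
      have "(\<lambda>n. 1 - \<delta> n) \<longlonglongrightarrow> 1"
        unfolding \<delta>_def using assms by real_asymp
      then have "(\<lambda>n. 1 - \<delta> n) \<sim>[sequentially] (\<lambda>_. 1)"
        by (intro asymp_equivI') simp
      \<comment> \<open>Multiplying equivalences instead of forming a quotient allows
        \<open>p n = 0\<close>.\<close>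
      then have "(\<lambda>n. p n ^ m * (1 - \<delta> n)) \<sim>[sequentially] (\<lambda>n. p n ^ m * 1)"
        by (intro asymp_equiv_mult asymp_equiv_refl)
      moreover have "eventually (\<lambda>n. p n ^ m * (1 - \<delta> n) = q n) sequentially"
        using eventually_gt_at_top[of 0] by eventually_elim (simp add: q_def)
      ultimately show ?thesis
        using asymp_equiv_cong[of "\<lambda>n. p n ^ m * (1 - \<delta> n)" q sequentially "\<lambda>n. p n ^ m * 1" "\<lambda>n. p n ^ m"]
        by (simp add: m_def)
    qed
    let ?S = "{(G, H). \<forall>h\<in>H. has_complete_graph_on G r h}"
    \<comment> \<open>A coupling is required for every \<open>n\<close>; where the estimates are not
      yet available the independent one serves.\<close>
    have "\<exists>J. is_coupling J (random_graph n (p n)) (random_hypergraph r n (q n)) \<and>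
      (n \<ge> 1 \<and> L * real n powr (- 1 / (4 * real r)) \<le> \<delta> n \<longrightarrow> 1 - \<eta> n \<le> measure_pmf.prob J ?S)" for n
    proof (cases "n \<ge> 1 \<and> L * real n powr (- 1 / (4 * real r)) \<le> \<delta> n")
      case False
      then show ?thesis
        by (intro exI[of _ "pair_pmf (random_graph n (p n)) (random_hypergraph r n (q n))"])
           (auto simp: is_coupling_def map_fst_pair_pmf map_snd_pair_pmf)
    next
      case True
      then have n: "n \<ge> 1" and L: "L * real n powr (- 1 / (4 * real r)) \<le> \<delta> n"
        by auto
      have "real (D n) \<le> real n powr (2 * a)"
        by (simp add: D_def)
      then have "(\<Sum>c\<in>{1..<r}. real r * real n ^ (c - 1) * real (r * (1 + D n * r) ^ (r * r)) ^ r *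
          p n ^ max 1 ((r choose 2) - (Suc (r - c) choose 2))) \<le> L * real n powr (- 1 / (4 * real r))"
        unfolding L_def using assms n p[OF n]
        by (intro transversal_sum_le[where \<epsilon>=\<epsilon>]) (auto simp: \<epsilon>_def a_def mult.assoc)
      also note L
      finally have sum_le: "(\<Sum>c\<in>{1..<r}. real r * real n ^ (c - 1) * real (r * (1 + D n * r) ^ (r * r)) ^ r *
          p n ^ max 1 ((r choose 2) - (Suc (r - c) choose 2))) \<le> \<delta> n" .
      have q_bound: "q n \<le> p n ^ (r choose 2) * (1 - \<delta> n)"
        using n by (simp add: q_def m_def)
      obtain J where J: "is_coupling J (random_graph n (p n)) (random_hypergraph r n (q n))"
        "1 \<le> measure_pmf.prob J ?S +
          (measure_pmf.prob (random_hypergraph r n (q n)) {H. \<exists>v. Suc (D n) \<le> card {g \<in> H. v \<in> g}} +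
           measure_pmf.prob (random_hypergraph r n (q n))
             {H. \<exists>X\<in>possible_hyperedges r n. X \<notin> H \<and> pairs X \<subseteq> shadow H})"
        by (rule clique_coupling_exists[OF p(1)[OF n] p1[OF n] conjunct1[OF q01] q_bound \<delta>[OF n] sum_le])
      have x: "real n ^ (r - 1) * q n \<le> real n powr a"
      proof -
        have "real n ^ (r - 1) * q n \<le> real n ^ (r - 1) * p n ^ m"
          using q_le[OF n] by (intro mult_left_mono) auto
        also have "\<dots> \<le> real n powr a"
          unfolding m_def a_def using assms n p[OF n] \<epsilon>0 by (intro expected_degree_le) auto
        finally show ?thesis .
      qed
      have x1: "1 \<le> real n powr a"
        using n a0 by (intro ge_one_powr_ge_zero) auto
      have "measure_pmf.prob (random_hypergraph r n (q n)) {H. \<exists>v. Suc (D n) \<le> card {g \<in> H. v \<in> g}} \<le>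
        real n * exp (2 * real n powr a) / 2 ^ Suc (D n)"
        using assms q01 x by (intro prob_large_degree_le) auto
      also have "\<dots> = real n * exp (2 * real n powr a) * 2 powr (- real (Suc (D n)))"
        by (simp add: powr_minus divide_inverse powr_realpow del: power_Suc of_nat_Suc)
      also have "\<dots> \<le> real n * exp (2 * real n powr a) * 2 powr (- (real n powr (2 * a)))"
      proof (intro mult_left_mono powr_mono)
        \<comment> \<open>The successor compensates for rounding down in \<open>D n\<close>.\<close>
        have "real n powr (2 * a) < of_int \<lfloor>real n powr (2 * a)\<rfloor> + 1"
          by linarith
        also have "\<dots> = real (Suc (D n))"
          by (simp add: D_def)
        finally show "- real (Suc (D n)) \<le> - (real n powr (2 * a))"
          by simp
      qed auto
      finally have d: "measure_pmf.prob (random_hypergraph r n (q n)) {H. \<exists>v. Suc (D n) \<le> card {g \<in> H. v \<in> g}} \<le>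
        real n * exp (2 * real n powr a) * 2 powr (- (real n powr (2 * a)))" .
      have "measure_pmf.prob (random_hypergraph r n (q n))
          {H. \<exists>X\<in>possible_hyperedges r n. X \<notin> H \<and> pairs X \<subseteq> shadow H} \<le>
        exp 1 * (2 ^ r * real n powr a) ^ (r choose 2) / real n"
        using assms n q01 x x1 by (intro prob_uncovered_clique_le) auto
      also have "\<dots> = exp 1 * (2 ^ r) ^ m * (real n powr (a * real m) / real n)"
        using n by (simp add: m_def power_mult_distrib powr_powr flip: powr_realpow)
      finally have "1 - \<eta> n \<le> measure_pmf.prob J ?S"
        using J(2) d by (simp add: \<eta>_def)
      then show ?thesis
        using J(1) by blast
    qed
    from choice[OF allI, OF this] obtain J
      where J': "\<forall>n. is_coupling (J n) (random_graph n (p n)) (random_hypergraph r n (q n)) \<and>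
        (n \<ge> 1 \<and> L * real n powr (- 1 / (4 * real r)) \<le> \<delta> n \<longrightarrow> 1 - \<eta> n \<le> measure_pmf.prob (J n) ?S)" ..
    then have J: "is_coupling (J n) (random_graph n (p n)) (random_hypergraph r n (q n))"
      "n \<ge> 1 \<Longrightarrow> L * real n powr (- 1 / (4 * real r)) \<le> \<delta> n \<Longrightarrow> 1 - \<eta> n \<le> measure_pmf.prob (J n) ?S" for n
      by auto
    define b where "b = 1 / (8 * real r)"
    have "0 < b" "0 < L"
      using assms by (auto simp: b_def L_def)
    then have "eventually (\<lambda>n. L * real n powr (- (2 * b)) \<le> real n powr (- b)) sequentially"
      by real_asymp
    then have "eventually (\<lambda>n. L * real n powr (- 1 / (4 * real r)) \<le> \<delta> n) sequentially"
      by (simp add: b_def \<delta>_def)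
    then have lower: "eventually (\<lambda>n. 1 - \<eta> n \<le> measure_pmf.prob (J n) ?S) sequentially"
      using eventually_ge_at_top[of 1] by eventually_elim (rule J(2))
    have "(\<lambda>n. real n * exp (2 * real n powr a) * 2 powr (- (real n powr (2 * a)))) \<longlonglongrightarrow> 0"
      using a0 by real_asymp
    moreover have "(\<lambda>n. exp 1 * (2 ^ r) ^ m * (real n powr (a * real m) / real n)) \<longlonglongrightarrow> 0"
      using am by real_asymp
    ultimately have "\<eta> \<longlonglongrightarrow> 0 + 0"
      unfolding \<eta>_def by (rule tendsto_add)
    then have "(\<lambda>n. 1 - \<eta> n) \<longlonglongrightarrow> 1 - 0"
      by (intro tendsto_diff) auto
    then have lim: "(\<lambda>n. 1 - \<eta> n) \<longlonglongrightarrow> 1"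
      by simp
    have "eventually (\<lambda>n. measure_pmf.prob (J n) ?S \<le> 1) sequentially"
      by (intro always_eventually allI measure_pmf.prob_le_1)
    from tendsto_sandwich[OF lower this lim tendsto_const]
    have "(\<lambda>n. measure_pmf.prob (J n) ?S) \<longlonglongrightarrow> 1" .
    then show "\<exists>q :: nat \<Rightarrow> real.
        (\<forall>n. 0 \<le> q n \<and> q n \<le> 1) \<and>
        q \<sim>[sequentially] (\<lambda>n. p n ^ (r choose 2)) \<and>
        (\<exists>J :: nat \<Rightarrow> (nat set set \<times> nat set set) pmf.
          (\<forall>n. is_coupling (J n) (random_graph n (p n)) (random_hypergraph r n (q n))) \<and>
          (\<lambda>n. measure_pmf.prob (J n) {(G, H). \<forall>h\<in>H. has_complete_graph_on G r h})
            \<longlonglongrightarrow> 1)"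
      using q01 asymp J(1) by blast
  qed
qed

end
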